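(* Let $q\ge p\ge1$, $\alpha>-1$, $u\in H(\mathbb{R}^2_+)$ and let $\varphi:\mathbb{R}^2_+\to\mathbb{R}^2_+$ be a holomorphic mapping. Suppose further that $W_{u,\varphi}:A^p_\alpha\to A^q_\alpha$ is bounded. Then for every $\gamma\ge1$ there is a constant $C>0$ (independent of $f$) such that for every $f\in A^p_\alpha$, $$\|W_{u,\varphi}f\|_{q,\alpha}^q\le C\inf_{N\in\mathbb{N},\,1\le N\le p}\left(\sum_{i=1}^3\sum_{I\in\mathcal{D}^i}\mu_{u,\varphi,q,\alpha}(Q_I)^{\frac1{\gamma'}}A_\alpha(Q_I)^{\frac{q}{p\gamma}}\,\langle|f|^N\rangle_{Q_I}\cdot\langle|f|^{q-N}\rangle_{Q_I,\gamma}\right).$$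
   Context: $\mathbb{R}^2_+=\{z\in\mathbb{C}:\operatorname{Im}z>0\}$ and $H(\mathbb{R}^2_+)$ is the set of holomorphic functions on $\mathbb{R}^2_+$. For $\alpha>-1$, $dA_\alpha(z)=\frac1\pi(\alpha+1)(2\operatorname{Im}z)^\alpha\,dx\,dy$ ($z=x+iy$), $A_\alpha(E)=\int_E dA_\alpha$, and for $0<p<\infty$, $\|f\|_{p,\alpha}=\left(\int_{\mathbb{R}^2_+}|f|^p\,dA_\alpha\right)^{1/p}$. The weighted Bergman space $A^p_\alpha$ is the set of $f\in H(\mathbb{R}^2_+)$ with $\|f\|_{p,\alpha}<\infty$. The weighted composition operator is $W_{u,\varphi}f(z)=u(z)f(\varphi(z))$; $W_{u,\varphi}:A^p_\alpha\to A^q_\alpha$ is bounded if there is $C$ with $\|W_{u,\varphi}f\|_{q,\alpha}\le C\|f\|_{p,\alpha}$ for all $f\in A^p_\alpha$. The measure $\mu_{u,\varphi,q,\alpha}$ on $\mathbb{R}^2_+$ is defined by $\mu_{u,\varphi,q,\alpha}(E)=\int_{\varphi^{-1}(E)}|u(z)|^q\,dA_\alpha(z)$. For an interval $I\subset\mathbb{R}$ of length $|I|=\ell(I)$, the Carleson box is $Q_I=\{x+iy\in\mathbb{R}^2_+:x\in I,\ y<|I|\}$. A dyadic grid on $\mathbb{R}$ is a collection $\mathcal{D}$ of intervals such that: each $I\in\mathcal{D}$ has $\ell(I)=2^k$ for some $k\in\mathbb{Z}$; for $I,J\in\mathcal{D}$, $I\cap J\in\{I,J,\emptyset\}$; and for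 every $k\in\mathbb{Z}$ the intervals of $\mathcal{D}$ of length $2^k$ form a partition of $\mathbb{R}$. $\mathcal{D}^1,\mathcal{D}^2,\mathcal{D}^3$ are three fixed dyadic grids such that for every interval $I$ there exist $k\in\{1,2,3\}$ and $J\in\mathcal{D}^k$ with $I\subset J$ and $\ell(J)\le3\ell(I)$. For measurable $E\subset\mathbb{R}^2_+$, $\gamma\ge1$ and $g\ge0$, $\langle g\rangle_{E,\gamma}=\left(\frac1{A_\alpha(E)}\int_E g^\gamma\,dA_\alpha\right)^{1/\gamma}$ and $\langle g\rangle_E=\langle g\rangle_{E,1}$. $\gamma'$ is the conjugate exponent, $\frac1\gamma+\frac1{\gamma'}=1$; for $\gamma=1$ the factor $\mu(Q_I)^{1/\gamma'}$ is read as $1$. When $N=q$, $|f|^{q-N}$ is read as the constant $1$. $\mathbb{N}$ denotes the positive integers. Sums of nonnegative terms may equal $+\infty$. *)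

theory Defs
  imports "HOL-Analysis.Analysis"
begin

definition upper_half_plane :: "complex set" where
  "upper_half_plane = {z. 0 < Im z}"

(* Real powers on [0,\<infinity>], used with exponents a \<ge> 0 only.  Unlike for powr on the reals,
   x to the power 0 is 1 for every x, including 0 and \<infinity>. *)
definition epowr :: "ennreal \<Rightarrow> real \<Rightarrow> ennreal" where
  "epowr x a = (if a = 0 then 1 else if x = \<infinity> then \<infinity> else ennreal (enn2real x powr a))"

definition bergman_measure :: "real \<Rightarrow> complex measure" where
  "bergman_measure \<alpha> =
     density (restrict_space lborel upper_half_plane)
       (\<lambda>z. ennreal (1 / pi * (\<alpha> + 1) * (2 * Im z) powr \<alpha>))"

definition bergman_norm :: "real \<Rightarrow> real \<Rightarrow> (complex \<Rightarrow> complex) \<Rightarrow> ennreal" where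
  "bergman_norm p \<alpha> f = epowr (\<integral>\<^sup>+z. ennreal (cmod (f z) powr p) \<partial>bergman_measure \<alpha>) (1 / p)"

definition bergman_space :: "real \<Rightarrow> real \<Rightarrow> (complex \<Rightarrow> complex) set" where
  "bergman_space p \<alpha> = {f. f holomorphic_on upper_half_plane \<and> bergman_norm p \<alpha> f < \<infinity>}"

definition weighted_comp :: "(complex \<Rightarrow> complex) \<Rightarrow> (complex \<Rightarrow> complex) \<Rightarrow> (complex \<Rightarrow> complex) \<Rightarrow> complex \<Rightarrow> complex" where
  "weighted_comp u \<phi> f z = u z * f (\<phi> z)"

definition weighted_comp_bounded :: "real \<Rightarrow> real \<Rightarrow> real \<Rightarrow> (complex \<Rightarrow> complex) \<Rightarrow> (complex \<Rightarrow> complex) \<Rightarrow> bool" where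
  "weighted_comp_bounded p q \<alpha> u \<phi> \<longleftrightarrow>
     (\<exists>C::real. C \<ge> 0 \<and> (\<forall>f\<in>bergman_space p \<alpha>.
        bergman_norm q \<alpha> (weighted_comp u \<phi> f) \<le> ennreal C * bergman_norm p \<alpha> f))"

definition pullback_measure :: "(complex \<Rightarrow> complex) \<Rightarrow> (complex \<Rightarrow> complex) \<Rightarrow> real \<Rightarrow> real \<Rightarrow> complex set \<Rightarrow> ennreal" where
  "pullback_measure u \<phi> q \<alpha> E =
     (\<integral>\<^sup>+z\<in>\<phi> -` E \<inter> upper_half_plane. ennreal (cmod (u z) powr q) \<partial>bergman_measure \<alpha>)"

(* Open, closed and half-open intervals are all allowed; the length is positive and finite
   (no interval of length 0 lies in a dyadic interval at most 3 times as long). *)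
definition bounded_interval :: "real set \<Rightarrow> bool" where
  "bounded_interval I \<longleftrightarrow> is_interval I \<and> bounded I \<and> 0 < measure lborel I"

abbreviation interval_length :: "real set \<Rightarrow> real" where
  "interval_length I \<equiv> measure lborel I"

definition carleson_box :: "real set \<Rightarrow> complex set" where
  "carleson_box I = {z\<in>upper_half_plane. Re z \<in> I \<and> Im z < interval_length I}"

definition dyadic_grid :: "real set set \<Rightarrow> bool" where
  "dyadic_grid D \<longleftrightarrow>
     (\<forall>I\<in>D. bounded_interval I \<and> (\<exists>k::int. interval_length I = 2 powi k)) \<and>
     (\<forall>I\<in>D. \<forall>J\<in>D. I \<inter> J \<in> {I, J, {}}) \<and>
     (\<forall>k::int. partition_on UNIV {I\<in>D. interval_length I = 2 powi k})"

definition avg :: "real \<Rightarrow> complex set \<Rightarrow> real \<Rightarrow> (complex \<Rightarrow> real) \<Rightarrow> ennreal" where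
  "avg \<alpha> E \<gamma> g =
     epowr ((\<integral>\<^sup>+z\<in>E. ennreal (g z powr \<gamma>) \<partial>bergman_measure \<alpha>) / emeasure (bergman_measure \<alpha>) E) (1 / \<gamma>)"

(* |f| to the power s for s \<ge> 0, read as the constant 1 if s = 0 (0 powr 0 is 0). *)
definition abs_pow :: "(complex \<Rightarrow> complex) \<Rightarrow> real \<Rightarrow> complex \<Rightarrow> real" where
  "abs_pow f s z = (if s = 0 then 1 else cmod (f z) powr s)"

end

theory Submission
  imports Defs "HOL-Complex_Analysis.Complex_Analysis"
begin

text \<open>
  Write \<open>\<mu>\<close> for the pullback measure and \<open>Q J\<close> for the Carleson box over \<open>J\<close>; then the left-hand
  side is the integral of \<open>cmod f powr q\<close> against \<open>\<mu>\<close>. The inequality comes from covering the half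
  plane by dyadic boxes on which both powers \<open>cmod f powr N\<close> and \<open>cmod f powr (q - N)\<close> are
  controlled by their averages.

  The estimate behind this is that for every \<open>s > 0\<close> the value of \<open>cmod f powr s\<close> at a point is at
  most a constant times its average over a disc about the point, although \<open>cmod f powr s\<close> need not be
  a convex function of \<open>cmod f\<close> (\<open>norm_powr_le_area_integral\<close>). For \<open>s = 1\<close> it follows from
  averaging Cauchy's formula over squares, for smaller \<open>s\<close> from a maximum argument of Hardy and
  Littlewood, and for larger \<open>s\<close> from passing to a power of \<open>f\<close>. Exponents below 1 cannot be avoided,
  since \<open>(q - N) * \<gamma>\<close> may be small.

  For a point \<open>z\<close> of the half plane, the property of the three grids provides a dyadic interval
  \<open>J\<close> of length comparable to \<open>Im z\<close> such that \<open>Q J\<close> contains the disc of radius \<open>Im z / 2\<close> about \<open>z\<close>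
  (\<open>dyadic_box_around_point\<close>). Disc and box have comparable measure, so the two powers of
  \<open>cmod f\<close> at \<open>z\<close> are bounded by their averages over \<open>Q J\<close> of order \<open>1\<close> and \<open>\<gamma>\<close>, respectively
  (\<open>abs_pow_le_avg\<close>). Their product bounds \<open>cmod (f z) powr q\<close> by a constant attached to \<open>J\<close>, and
  summation over all \<open>J\<close> followed by integration against \<open>\<mu>\<close> yields, up to a constant, the sum over
  \<open>J\<close> of \<open>\<mu> (Q J)\<close> times the two averages.

  It remains to exchange part of \<open>\<mu> (Q J)\<close> for the area of \<open>Q J\<close>. Boundedness of the operator,
  tested on negative powers of \<open>z - w\<close> with \<open>w\<close> below the real axis, shows that
  \<open>\<mu> (Q J)\<close> is at most a constant times the area of \<open>Q J\<close> to the power \<open>q / p\<close>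
  (\<open>pullback_measure_carleson_box_le\<close>). This is applied to the second
  factor of \<open>\<mu> (Q J) = epowr (\<mu> (Q J)) (1 - 1 / \<gamma>) * epowr (\<mu> (Q J)) (1 / \<gamma>)\<close>.
\<close>

section \<open>Integration over the complex plane in coordinates\<close>

lemma measurable_Complex [measurable (raw)]:
  assumes "f \<in> borel_measurable M" "g \<in> borel_measurable M"
  shows "(\<lambda>x. Complex (f x) (g x)) \<in> borel_measurable M"
  unfolding Complex_eq using assms by measurable

lemma lborel_complex_eq_distr_prod:
  "lborel = distr (lborel \<Otimes>\<^sub>M lborel) borel (\<lambda>(x, y). Complex x y)"
proof (rule lborel_eqI)
  fix l u :: complex
  assume le: "\<And>b. b \<in> Basis \<Longrightarrow> l \<bullet> b \<le> u \<bullet> b"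
  have re: "Re l \<le> Re u" and im: "Im l \<le> Im u"
    using le[of 1] le[of \<i>] by (auto simp: Basis_complex_def)
  have eq: "(\<lambda>(x, y). Complex x y) -` box l u \<inter> space (lborel \<Otimes>\<^sub>M lborel)
      = {Re l <..< Re u} \<times> {Im l <..< Im u}"
    by (auto simp: in_box_complex_iff space_pair_measure)
  have "emeasure (distr (lborel \<Otimes>\<^sub>M lborel) borel (\<lambda>(x, y). Complex x y)) (box l u)
      = emeasure (lborel \<Otimes>\<^sub>M lborel) ({Re l <..< Re u} \<times> {Im l <..< Im u})"
    by (subst emeasure_distr) (auto simp: eq)
  also have "\<dots> = ennreal (Re u - Re l) * ennreal (Im u - Im l)"
    using re im by (simp add: lborel.emeasure_pair_measure_Times)
  finally show "emeasure (distr (lborel \<Otimes>\<^sub>M lborel) borel (\<lambda>(x, y). Complex x y)) (box l u)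
      = (\<Prod>b\<in>Basis. (u - l) \<bullet> b)"
    using re im by (simp add: Basis_complex_def complex_eq_iff ennreal_mult)
qed simp

lemma nn_integral_complex_iterated:
  assumes [measurable]: "h \<in> borel_measurable borel"
  shows "(\<integral>\<^sup>+w. h w \<partial>lborel) = (\<integral>\<^sup>+x. \<integral>\<^sup>+y. h (Complex x y) \<partial>lborel \<partial>lborel)"
    and "(\<integral>\<^sup>+w. h w \<partial>lborel) = (\<integral>\<^sup>+y. \<integral>\<^sup>+x. h (Complex x y) \<partial>lborel \<partial>lborel)"
proof -
  have "(\<integral>\<^sup>+w. h w \<partial>lborel) = (\<integral>\<^sup>+xy. h (Complex (fst xy) (snd xy)) \<partial>(lborel \<Otimes>\<^sub>M lborel))"
    by (subst lborel_complex_eq_distr_prod, subst nn_integral_distr)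
       (auto simp: case_prod_beta)
  also have "\<dots> = (\<integral>\<^sup>+x. \<integral>\<^sup>+y. h (Complex x y) \<partial>lborel \<partial>lborel)"
    by (subst lborel.nn_integral_fst[symmetric]) auto
  finally show 1: "(\<integral>\<^sup>+w. h w \<partial>lborel) = (\<integral>\<^sup>+x. \<integral>\<^sup>+y. h (Complex x y) \<partial>lborel \<partial>lborel)" .
  also have "\<dots> = (\<integral>\<^sup>+y. \<integral>\<^sup>+x. h (Complex x y) \<partial>lborel \<partial>lborel)"
    by (rule lborel_pair.Fubini'[symmetric]) measurable
  finally show "(\<integral>\<^sup>+w. h w \<partial>lborel) = (\<integral>\<^sup>+y. \<integral>\<^sup>+x. h (Complex x y) \<partial>lborel \<partial>lborel)" .
qed

section \<open>Point values of a holomorphic function and area integrals of its powers\<close>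

lemma norm_contour_integral_linepath_le_nn_integral:
  assumes "continuous_on (closed_segment a b) g"
  shows "ennreal (cmod (contour_integral (linepath a b) g))
    \<le> ennreal (cmod (b - a)) * (\<integral>\<^sup>+s\<in>{0..1}. ennreal (cmod (g (linepath a b s))) \<partial>lborel)"
proof -
  let ?F = "\<lambda>s. g (linepath a b s)"
  have cont: "continuous_on {0..1} ?F"
    by (rule continuous_on_compose2[OF assms continuous_on_linepath])
       (auto simp: linepath_image_01[symmetric] simp del: linepath_image_01)
  have int: "set_integrable lborel {0..1} ?F"
    unfolding set_integrable_def by (rule borel_integrable_compact[OF _ cont]) simp
  have "contour_integral (linepath a b) g = (b - a) * integral {0..1} ?F"
    by (simp add: contour_integral_integral)
  also have "integral {0..1} ?F = (LINT s:{0..1}|lborel. ?F s)"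
    using set_borel_integral_eq_integral(2)[OF int] by simp
  finally have eq: "contour_integral (linepath a b) g = (b - a) * (LINT s:{0..1}|lborel. ?F s)" .
  have "ennreal (cmod (LINT s:{0..1}|lborel. ?F s))
      \<le> (\<integral>\<^sup>+s. ennreal (cmod (indicator {0..1} s *\<^sub>R ?F s)) \<partial>lborel)"
    using int unfolding set_lebesgue_integral_def set_integrable_def
    by (rule integral_norm_bound_ennreal)
  also have "\<dots> = (\<integral>\<^sup>+s\<in>{0..1}. ennreal (cmod (?F s)) \<partial>lborel)"
    by (intro nn_integral_cong) (auto simp: indicator_def)
  finally show ?thesis
    unfolding eq norm_mult by (simp add: ennreal_mult mult_left_mono)
qed

text \<open>The bound is by an integral over the whole line through the segment, with an integrand \<open>G\<close>
  on the plane: when the line is moved afterwards, these integrals are the inner integrals of a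
  Tonelli iteration of \<open>\<integral> G\<close>.\<close>

lemma norm_contour_integral_horizontal_le:
  assumes "continuous_on (closed_segment (Complex a y) (Complex b y)) g" and "a \<noteq> b"
    and [measurable]: "G \<in> borel_measurable borel"
    and le: "\<And>w. w \<in> closed_segment (Complex a y) (Complex b y) \<Longrightarrow> ennreal (cmod (g w)) \<le> G w"
  shows "ennreal (cmod (contour_integral (linepath (Complex a y) (Complex b y)) g))
    \<le> (\<integral>\<^sup>+x. G (Complex x y) \<partial>lborel)"
proof -
  let ?l = "linepath (Complex a y) (Complex b y)"
  have l: "?l s = Complex (a + (b - a) * s) y" for s
    by (simp add: linepath_def complex_eq_iff algebra_simps)
  have n: "cmod (Complex b y - Complex a y) = \<bar>b - a\<bar>"
    by (simp add: cmod_def)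
  have "ennreal (cmod (contour_integral ?l g))
      \<le> ennreal \<bar>b - a\<bar> * (\<integral>\<^sup>+s\<in>{0..1}. ennreal (cmod (g (?l s))) \<partial>lborel)"
    using norm_contour_integral_linepath_le_nn_integral[OF assms(1)] unfolding n .
  also have "\<dots> \<le> ennreal \<bar>b - a\<bar> * (\<integral>\<^sup>+s. G (Complex (a + (b - a) * s) y) \<partial>lborel)"
    by (intro mult_left_mono nn_integral_mono)
       (auto simp: indicator_def l[symmetric] intro!: le linepath_in_path)
  also have "\<dots> = (\<integral>\<^sup>+x. G (Complex x y) \<partial>lborel)"
    using \<open>a \<noteq> b\<close> by (subst nn_integral_real_affine[where c="b - a" and t=a, of "\<lambda>x. G (Complex x y)"]) auto
  finally show ?thesis .
qed

lemma norm_contour_integral_vertical_le: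
  assumes "continuous_on (closed_segment (Complex x a) (Complex x b)) g" and "a \<noteq> b"
    and [measurable]: "G \<in> borel_measurable borel"
    and le: "\<And>w. w \<in> closed_segment (Complex x a) (Complex x b) \<Longrightarrow> ennreal (cmod (g w)) \<le> G w"
  shows "ennreal (cmod (contour_integral (linepath (Complex x a) (Complex x b)) g))
    \<le> (\<integral>\<^sup>+y. G (Complex x y) \<partial>lborel)"
proof -
  let ?l = "linepath (Complex x a) (Complex x b)"
  have l: "?l s = Complex x (a + (b - a) * s)" for s
    by (simp add: linepath_def complex_eq_iff algebra_simps)
  have n: "cmod (Complex x b - Complex x a) = \<bar>b - a\<bar>"
    by (simp add: cmod_def)
  have "ennreal (cmod (contour_integral ?l g))
      \<le> ennreal \<bar>b - a\<bar> * (\<integral>\<^sup>+s\<in>{0..1}. ennreal (cmod (g (?l s))) \<partial>lborel)"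
    using norm_contour_integral_linepath_le_nn_integral[OF assms(1)] unfolding n .
  also have "\<dots> \<le> ennreal \<bar>b - a\<bar> * (\<integral>\<^sup>+s. G (Complex x (a + (b - a) * s)) \<partial>lborel)"
    by (intro mult_left_mono nn_integral_mono)
       (auto simp: indicator_def l[symmetric] intro!: le linepath_in_path)
  also have "\<dots> = (\<integral>\<^sup>+y. G (Complex x y) \<partial>lborel)"
    using \<open>a \<noteq> b\<close> by (subst nn_integral_real_affine[where c="b - a" and t=a, of "\<lambda>y. G (Complex x y)"]) auto
  finally show ?thesis .
qed

lemma borel_measurable_norm_powr_indicator:
  fixes s :: real
  assumes "continuous_on S f" and "open S"
  shows "(\<lambda>w. ennreal (cmod (f w) powr s) * indicator S w) \<in> borel_measurable borel"
proof -
  have "f \<in> borel_measurable (restrict_space borel S)"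
    by (rule borel_measurable_continuous_on_restrict[OF assms(1)])
  then have "(\<lambda>w. ennreal (cmod (f w) powr s)) \<in> borel_measurable (restrict_space borel S)"
    by measurable
  then show ?thesis
    using \<open>open S\<close> by (subst (asm) borel_measurable_restrict_space_iff_ennreal) auto
qed

text \<open>Cauchy's formula on the boundary of the square with centre \<open>z\<close> and half side \<open>t\<close>, on which
  the kernel is at most \<open>1 / t\<close>. Squares are used because averaging over \<open>t\<close> then only needs
  Cartesian coordinates. The condition \<open>2 * t \<le> R\<close> puts the corners, at distance
  \<open>sqrt 2 * t\<close> from \<open>z\<close>, inside the disc.\<close>

lemma norm_le_four_side_integrals:
  fixes f :: "complex \<Rightarrow> complex"
  assumes holo: "f holomorphic_on ball z R" and t: "0 < t" "2 * t \<le> R"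
  defines "h \<equiv> (\<lambda>w. ennreal (cmod (f w)) * indicator (ball z R) w)"
  shows "ennreal (2 * pi * t * cmod (f z)) \<le>
     ((\<integral>\<^sup>+x. h (Complex x (Im z - t)) \<partial>lborel) + (\<integral>\<^sup>+y. h (Complex (Re z + t) y) \<partial>lborel))
     + ((\<integral>\<^sup>+x. h (Complex x (Im z + t)) \<partial>lborel) + (\<integral>\<^sup>+y. h (Complex (Re z - t) y) \<partial>lborel))"
proof -
  define a1 a3 where "a1 = Complex (Re z - t) (Im z - t)" and "a3 = Complex (Re z + t) (Im z + t)"
  define a2 a4 where "a2 = Complex (Re z + t) (Im z - t)" and "a4 = Complex (Re z - t) (Im z + t)"
  note a_defs = a1_def a2_def a3_def a4_def
  define g where "g = (\<lambda>w. f w / (w - z))"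
  define S where "S = ((\<integral>\<^sup>+x. h (Complex x (Im z - t)) \<partial>lborel) + (\<integral>\<^sup>+y. h (Complex (Re z + t) y) \<partial>lborel))
     + ((\<integral>\<^sup>+x. h (Complex x (Im z + t)) \<partial>lborel) + (\<integral>\<^sup>+y. h (Complex (Re z - t) y) \<partial>lborel))"
  have meas [measurable]: "h \<in> borel_measurable borel"
    using borel_measurable_norm_powr_indicator[OF holomorphic_on_imp_continuous_on[OF holo], of 1]
    by (simp add: h_def)
  have boundary: "path_image (rectpath a1 a3) = cbox a1 a3 - box a1 a3"
    using t by (intro path_image_rectpath_cbox_minus_box) (auto simp: a_defs)
  have z_in: "z \<in> box a1 a3"
    using t by (auto simp: a_defs in_box_complex_iff)
  have in_ball: "w \<in> ball z R" and far: "t \<le> cmod (w - z)"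
    if "w \<in> path_image (rectpath a1 a3)" for w
  proof -
    have c: "\<bar>Re (w - z)\<bar> \<le> t" "\<bar>Im (w - z)\<bar> \<le> t" and e: "\<bar>Re (w - z)\<bar> = t \<or> \<bar>Im (w - z)\<bar> = t"
      using that t unfolding boundary by (auto simp: a_defs in_box_complex_iff in_cbox_complex_iff)
    show "t \<le> cmod (w - z)"
      using e abs_Re_le_cmod[of "w - z"] abs_Im_le_cmod[of "w - z"] by auto
    have "(cmod (w - z))\<^sup>2 \<le> t\<^sup>2 + t\<^sup>2"
      unfolding cmod_power2 using c t by (intro add_mono abs_le_square_iff[THEN iffD1]) auto
    also have "\<dots> < (2 * t)\<^sup>2"
      using t by (simp add: power2_eq_square)
    finally have "cmod (w - z) < 2 * t"
      by (rule power2_less_imp_less) (use t in simp)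
    then show "w \<in> ball z R"
      using t by (simp add: dist_norm norm_minus_commute)
  qed
  have sides: "path_image (rectpath a1 a3) = closed_segment a1 a2 \<union> closed_segment a2 a3
      \<union> closed_segment a3 a4 \<union> closed_segment a4 a1"
    by (simp add: rectpath_def Let_def path_image_join Un_assoc a_defs)
  have g_le: "ennreal (cmod (g w)) \<le> ennreal (1 / t) * h w" if "w \<in> path_image (rectpath a1 a3)" for w
  proof -
    have "cmod (g w) \<le> 1 / t * cmod (f w)"
      using far[OF that] t unfolding g_def norm_divide
      by (simp add: frac_le)
    then show ?thesis
      using in_ball[OF that] t by (simp add: h_def ennreal_mult[symmetric] del: times_divide_eq_left)
  qed
  have g_cont: "continuous_on (path_image (rectpath a1 a3)) g"
  proof -
    have "continuous_on (path_image (rectpath a1 a3)) f"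
      using in_ball by (intro continuous_on_subset[OF holomorphic_on_imp_continuous_on[OF holo]]) auto
    then show ?thesis
      unfolding g_def using far t by (intro continuous_intros) fastforce+
  qed
  have "(g has_contour_integral (2 * pi * \<i> * winding_number (rectpath a1 a3) z * f z)) (rectpath a1 a3)"
    unfolding g_def using t boundary z_in in_ball[unfolded mem_ball] holo
    by (intro Cauchy_integral_formula_convex_simple[of "ball z R"]) auto
  then have "contour_integral (rectpath a1 a3) g = 2 * pi * \<i> * f z"
    using winding_number_rectpath[OF z_in] by (simp add: contour_integral_unique)
  moreover have "contour_integral (rectpath a1 a3) g
      = contour_integral (linepath a1 a2) g + contour_integral (linepath a2 a3) g
        + (contour_integral (linepath a3 a4) g + contour_integral (linepath a4 a1) g)"
  proof -
    have "g contour_integrable_on linepath a1 a2" "g contour_integrable_on linepath a2 a3"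
      "g contour_integrable_on linepath a3 a4" "g contour_integrable_on linepath a4 a1"
      using g_cont unfolding sides
      by (auto intro!: contour_integrable_continuous_linepath intro: continuous_on_subset)
    moreover have "rectpath a1 a3 = linepath a1 a2 +++ linepath a2 a3 +++ linepath a3 a4 +++ linepath a4 a1"
      by (simp add: rectpath_def Let_def a_defs)
    ultimately show ?thesis
      by (simp add: contour_integrable_joinI)
  qed
  ultimately have "cmod (2 * pi * \<i> * f z)
      \<le> cmod (contour_integral (linepath a1 a2) g) + cmod (contour_integral (linepath a2 a3) g)
        + (cmod (contour_integral (linepath a3 a4) g) + cmod (contour_integral (linepath a4 a1) g))"
    by (metis norm_triangle_le norm_triangle_ineq add_mono)
  then have "ennreal (2 * pi * cmod (f z))
      \<le> (ennreal (cmod (contour_integral (linepath a1 a2) g)) + ennreal (cmod (contour_integral (linepath a2 a3) g)))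
       + (ennreal (cmod (contour_integral (linepath a3 a4) g)) + ennreal (cmod (contour_integral (linepath a4 a1) g)))"
    by (simp add: norm_mult ennreal_plus[symmetric] ennreal_leI del: ennreal_plus)
  also have "\<dots> \<le> ((\<integral>\<^sup>+x. ennreal (1 / t) * h (Complex x (Im z - t)) \<partial>lborel) + (\<integral>\<^sup>+y. ennreal (1 / t) * h (Complex (Re z + t) y) \<partial>lborel))
     + ((\<integral>\<^sup>+x. ennreal (1 / t) * h (Complex x (Im z + t)) \<partial>lborel) + (\<integral>\<^sup>+y. ennreal (1 / t) * h (Complex (Re z - t) y) \<partial>lborel))"
  proof -
    have cont: "continuous_on (closed_segment a1 a2) g" "continuous_on (closed_segment a2 a3) g"
      "continuous_on (closed_segment a3 a4) g" "continuous_on (closed_segment a4 a1) g"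
      using g_cont unfolding sides by (auto intro: continuous_on_subset)
    have le: "ennreal (cmod (g w)) \<le> ennreal (1 / t) * h w"
      if "w \<in> closed_segment a1 a2 \<or> w \<in> closed_segment a2 a3
        \<or> w \<in> closed_segment a3 a4 \<or> w \<in> closed_segment a4 a1" for w
      using g_le that unfolding sides by blast
    show ?thesis
      using t cont le unfolding a_defs
      by (intro add_mono norm_contour_integral_horizontal_le[where G="\<lambda>w. ennreal (1 / t) * h w"]
          norm_contour_integral_vertical_le[where G="\<lambda>w. ennreal (1 / t) * h w"]) simp_all
  qed
  also have "\<dots> = ennreal (1 / t) * S"
    unfolding S_def by (simp add: nn_integral_cmult distrib_left)
  finally have le: "ennreal (2 * pi * cmod (f z)) \<le> ennreal (1 / t) * S" .
  have "2 * pi * t * cmod (f z) = t * (2 * pi * cmod (f z))"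
    by simp
  then have "ennreal (2 * pi * t * cmod (f z)) = ennreal t * ennreal (2 * pi * cmod (f z))"
    using t by (simp add: ennreal_mult mult_ac)
  also have "\<dots> \<le> ennreal t * (ennreal (1 / t) * S)"
    using le by (rule mult_left_mono) simp
  also have "\<dots> = ennreal (t * (1 / t)) * S"
    using t by (subst ennreal_mult) (auto simp: mult.assoc)
  finally show ?thesis
    using t by (simp add: S_def)
qed

text \<open>Integrate the bound by four sides over \<open>R / 4 \<le> t \<le> R / 2\<close>: as \<open>t\<close> runs, the line
  through each side moves across the plane in one direction, so each of the four terms contributes
  at most the area integral.\<close>

lemma norm_le_area_integral:
  assumes holo: "f holomorphic_on ball z R" and R: "0 < R"
  shows "ennreal (R\<^sup>2 * cmod (f z)) \<le> 16 * (\<integral>\<^sup>+w\<in>ball z R. ennreal (cmod (f w)) \<partial>lborel)"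
proof -
  define h where "h = (\<lambda>w. ennreal (cmod (f w)) * indicator (ball z R) w)"
  have [measurable]: "h \<in> borel_measurable borel"
    using borel_measurable_norm_powr_indicator[OF holomorphic_on_imp_continuous_on[OF holo], of 1]
    by (simp add: h_def)
  define B L T V where "B = (\<lambda>t. \<integral>\<^sup>+x. h (Complex x t) \<partial>lborel)" and "L = (\<lambda>t. \<integral>\<^sup>+y. h (Complex t y) \<partial>lborel)"
    and "T = (\<integral>\<^sup>+w. h w \<partial>lborel)" and "V = {R/4..R/2}"
  have [measurable]: "B \<in> borel_measurable borel" "L \<in> borel_measurable borel"
    unfolding B_def L_def by measurable
  have BT: "(\<integral>\<^sup>+t. B t \<partial>lborel) = T" and LT: "(\<integral>\<^sup>+t. L t \<partial>lborel) = T"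
    unfolding B_def L_def T_def using nn_integral_complex_iterated[of h] by simp_all
  have shift: "(\<integral>\<^sup>+t. B (Im z - t) \<partial>lborel) = T" "(\<integral>\<^sup>+t. B (Im z + t) \<partial>lborel) = T"
    "(\<integral>\<^sup>+t. L (Re z - t) \<partial>lborel) = T" "(\<integral>\<^sup>+t. L (Re z + t) \<partial>lborel) = T"
    using nn_integral_real_affine[of B "-1" "Im z"] nn_integral_real_affine[of B 1 "Im z"]
      nn_integral_real_affine[of L "-1" "Re z"] nn_integral_real_affine[of L 1 "Re z"]
    by (simp_all add: BT LT)
  have "ennreal (R / 4) * ennreal (pi * R / 2 * cmod (f z)) = (\<integral>\<^sup>+t\<in>V. ennreal (pi * R / 2 * cmod (f z)) \<partial>lborel)"
    using R by (simp add: V_def nn_integral_cmult_indicator mult.commute)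
  also have "\<dots> \<le> (\<integral>\<^sup>+t. (B (Im z - t) + L (Re z + t)) + (B (Im z + t) + L (Re z - t)) \<partial>lborel)"
  proof (rule nn_integral_mono)
    fix t
    show "ennreal (pi * R / 2 * cmod (f z)) * indicator V t
        \<le> (B (Im z - t) + L (Re z + t)) + (B (Im z + t) + L (Re z - t))"
    proof (cases "t \<in> V")
      case True
      then have t: "0 < t" "2 * t \<le> R" "R / 4 \<le> t"
        using R by (auto simp: V_def)
      have "pi * R / 2 * cmod (f z) \<le> 2 * pi * t * cmod (f z)"
        using t by (intro mult_right_mono) (auto simp: mult_left_mono)
      then have "ennreal (pi * R / 2 * cmod (f z)) \<le> ennreal (2 * pi * t * cmod (f z))"
        by (rule ennreal_leI)
      also have "\<dots> \<le> (B (Im z - t) + L (Re z + t)) + (B (Im z + t) + L (Re z - t))"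
        unfolding B_def L_def h_def by (rule norm_le_four_side_integrals[OF holo t(1,2)])
      finally show ?thesis
        using True by simp
    qed simp
  qed
  also have "\<dots> = 4 * T"
  proof -
    have "T + T + (T + T) = 4 * T"
      by (simp add: mult_2[symmetric] mult.assoc[symmetric])
    then show ?thesis
      by (simp add: nn_integral_add shift)
  qed
  finally have *: "ennreal (R / 4 * (pi * R / 2 * cmod (f z))) \<le> 4 * T"
    using R by (subst ennreal_mult) auto
  \<comment> \<open>the crude bound \<open>\<pi> \<ge> 2\<close> accounts for the constant 16\<close>
  have "R\<^sup>2 * cmod (f z) * 2 \<le> R\<^sup>2 * cmod (f z) * pi"
    using pi_ge_two by (intro mult_left_mono) auto
  then have "R\<^sup>2 * cmod (f z) \<le> 4 * (R / 4 * (pi * R / 2 * cmod (f z)))"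
    by (simp add: power2_eq_square mult_ac)
  then have "ennreal (R\<^sup>2 * cmod (f z)) \<le> ennreal (4 * (R / 4 * (pi * R / 2 * cmod (f z))))"
    by (rule ennreal_leI)
  also have "\<dots> = 4 * ennreal (R / 4 * (pi * R / 2 * cmod (f z)))"
    by (subst ennreal_mult') auto
  also have "\<dots> \<le> 4 * (4 * T)"
    using * by (rule mult_left_mono) simp
  also have "\<dots> = 16 * T"
    by (simp add: mult.assoc[symmetric])
  finally show ?thesis
    by (simp add: T_def h_def)
qed


text \<open>For \<open>s < 1\<close> the function \<open>t \<mapsto> t powr s\<close> is concave, so the bound for the first power does
  not pass to the power \<open>s\<close> by Jensen's inequality. The argument of Hardy and Littlewood is used
  instead. Let \<open>w0\<close> maximise \<open>(r - dist z w)\<^sup>2 * cmod (f w) powr s\<close> over the disc of radius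
  \<open>r = R / 2\<close> about \<open>z\<close>, and let \<open>d\<close> be the distance of \<open>w0\<close> to the boundary of that disc.
  On the disc of radius \<open>d / 2\<close> about \<open>w0\<close> the weight falls by a factor of at most 4, so
  \<open>cmod (f w) powr s \<le> 4 * cmod (f w0) powr s\<close> there. Hence, in the estimate of the first power at \<open>w0\<close>,
  the factor \<open>cmod (f w) powr (1 - s)\<close> of the integrand can be replaced by a multiple of
  \<open>cmod (f w0) powr (1 - s)\<close> and cancelled. This bounds the maximum of the weighted function,
  hence its value at \<open>z\<close>.\<close>

lemma norm_powr_le_area_integral_small:
  fixes s :: real
  assumes s: "0 < s" "s \<le> 1" and holo: "f holomorphic_on ball z R" and R: "0 < R"
  shows "ennreal (R\<^sup>2 * cmod (f z) powr s)
    \<le> ennreal (256 * 4 powr ((1 - s) / s)) * (\<integral>\<^sup>+w\<in>ball z R. ennreal (cmod (f w) powr s) \<partial>lborel)"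
proof (cases "f z = 0")
  case False
  define r where "r = R / 2"
  have r: "0 < r" "r < R"
    using R by (auto simp: r_def)
  define m where "m = (\<lambda>w. (r - dist z w)\<^sup>2 * cmod (f w) powr s)"
  have cont: "continuous_on (cball z r) f"
    using r by (intro continuous_on_subset[OF holomorphic_on_imp_continuous_on[OF holo]]) auto
  have "continuous_on (cball z r) m"
    unfolding m_def using s by (intro continuous_intros cont continuous_on_powr') auto
  then obtain w0 where w0: "w0 \<in> cball z r" and max: "\<And>w. w \<in> cball z r \<Longrightarrow> m w \<le> m w0"
    using continuous_attains_sup[of "cball z r" m] r by fastforce
  define d where "d = r - dist z w0"
  have m_z: "r\<^sup>2 * cmod (f z) powr s \<le> m w0"
    using max[of z] r by (simp add: m_def)
  have "0 < r\<^sup>2 * cmod (f z) powr s"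
    using r False by simp
  then have "m w0 > 0"
    using m_z by linarith
  then have fw0: "cmod (f w0) > 0" and "d \<noteq> 0"
    by (auto simp: m_def d_def)
  then have d: "0 < d"
    using w0 by (simp add: d_def)
  have margin: "d / 2 \<le> r - dist z w" if "w \<in> ball w0 (d / 2)" for w
    using that dist_triangle[of z w w0] by (simp add: d_def dist_commute field_simps)
  have sub: "ball w0 (d / 2) \<subseteq> cball z r"
    using margin d by fastforce
  define k where "k = 4 powr ((1 - s) / s) * cmod (f w0) powr (1 - s)"
  have k: "0 < k"
    using fw0 by (simp add: k_def)
  have near: "cmod (f w) \<le> k * cmod (f w) powr s" if w: "w \<in> ball w0 (d / 2)" for w
  proof -
    have "(d / 2)\<^sup>2 * cmod (f w) powr s \<le> m w"
      unfolding m_def using margin[OF w] d by (intro mult_right_mono power_mono) auto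
    also have "\<dots> \<le> d\<^sup>2 * cmod (f w0) powr s"
      using max[of w] w sub by (auto simp: m_def d_def)
    finally have "cmod (f w) powr s \<le> 4 * cmod (f w0) powr s"
      using d by (simp add: power_divide field_simps)
    then have "(cmod (f w) powr s) powr ((1 - s) / s) \<le> (4 * cmod (f w0) powr s) powr ((1 - s) / s)"
      using s by (intro powr_mono2) auto
    then have "cmod (f w) powr (1 - s) \<le> k"
      using s by (simp add: powr_powr powr_mult k_def)
    then have "cmod (f w) powr (1 - s) * cmod (f w) powr s \<le> k * cmod (f w) powr s"
      by (rule mult_right_mono) simp
    then show ?thesis
      by (simp add: powr_add[symmetric])
  qed
  define T where "T = (\<integral>\<^sup>+w\<in>ball z R. ennreal (cmod (f w) powr s) \<partial>lborel)"
  have sub': "ball w0 (d / 2) \<subseteq> ball z R"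
    using sub r by auto
  have meas: "(\<lambda>w. ennreal (cmod (f w) powr s) * indicator (ball w0 (d / 2)) w) \<in> borel_measurable borel"
    using sub' holo s by (intro borel_measurable_norm_powr_indicator)
      (auto intro: holomorphic_on_imp_continuous_on holomorphic_on_subset)
  have "ennreal ((d / 2)\<^sup>2 * cmod (f w0)) \<le> 16 * (\<integral>\<^sup>+w\<in>ball w0 (d / 2). ennreal (cmod (f w)) \<partial>lborel)"
    using holo sub' d by (intro norm_le_area_integral) (auto intro: holomorphic_on_subset)
  also have "\<dots> \<le> 16 * (\<integral>\<^sup>+w. ennreal k * (ennreal (cmod (f w) powr s) * indicator (ball w0 (d / 2)) w) \<partial>lborel)"
    using near k by (intro mult_left_mono nn_integral_mono)
      (auto simp: indicator_def ennreal_mult[symmetric] intro!: ennreal_leI)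
  also have "\<dots> = 16 * (ennreal k * (\<integral>\<^sup>+w. (ennreal (cmod (f w) powr s) * indicator (ball w0 (d / 2)) w) \<partial>lborel))"
    using meas by (subst nn_integral_cmult) auto
  also have "\<dots> \<le> 16 * (ennreal k * T)"
    unfolding T_def using sub' by (intro mult_left_mono nn_integral_mono) (auto simp: indicator_def)
  finally have *: "ennreal ((d / 2)\<^sup>2 * cmod (f w0)) \<le> ennreal (16 * k) * T"
    using k by (simp add: ennreal_mult mult.assoc)
  define c where "c = 16 / cmod (f w0) powr (1 - s)"
  have c: "0 < c"
    using fw0 by (simp add: c_def)
  have "R\<^sup>2 * cmod (f z) powr s = 4 * (r\<^sup>2 * cmod (f z) powr s)"
    by (simp add: r_def power2_eq_square)
  also have "\<dots> \<le> 4 * (d\<^sup>2 * cmod (f w0) powr s)"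
    using m_z by (simp add: m_def d_def)
  also have "\<dots> = c * ((d / 2)\<^sup>2 * cmod (f w0))"
  proof -
    have "cmod (f w0) = cmod (f w0) powr s * cmod (f w0) powr (1 - s)"
      by (simp add: powr_add[symmetric])
    then show ?thesis
      using fw0 unfolding c_def by (simp add: field_simps power2_eq_square)
  qed
  finally have "ennreal (R\<^sup>2 * cmod (f z) powr s) \<le> ennreal (c * ((d / 2)\<^sup>2 * cmod (f w0)))"
    by (rule ennreal_leI)
  also have "\<dots> = ennreal c * ennreal ((d / 2)\<^sup>2 * cmod (f w0))"
    using c by (intro ennreal_mult) auto
  also have "\<dots> \<le> ennreal c * (ennreal (16 * k) * T)"
    using * by (rule mult_left_mono) simp
  also have "\<dots> = ennreal (c * (16 * k)) * T"
    using c k by (simp add: ennreal_mult mult.assoc)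
  also have "c * (16 * k) = 256 * 4 powr ((1 - s) / s)"
    using fw0 by (simp add: c_def k_def)
  finally show ?thesis
    by (simp add: T_def)
qed (use s in simp)

text \<open>The restriction \<open>s \<le> 1\<close> is removed by replacing \<open>f\<close> with the holomorphic function \<open>f ^ n\<close>
  and \<open>s\<close> with \<open>s / n\<close>.\<close>

lemma norm_powr_le_area_integral:
  fixes s :: real
  assumes s: "0 < s"
  obtains K where "0 < K" and "\<And>f z R. f holomorphic_on ball z R \<Longrightarrow> 0 < R \<Longrightarrow>
    ennreal (R\<^sup>2 * cmod (f z) powr s) \<le> ennreal K * (\<integral>\<^sup>+w\<in>ball z R. ennreal (cmod (f w) powr s) \<partial>lborel)"
proof -
  define n where "n = nat \<lceil>s\<rceil>"
  define t where "t = s / n"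
  have n: "0 < n" "s \<le> n"
    using s by (auto simp: n_def)
  then have t: "0 < t" "t \<le> 1"
    using s by (auto simp: t_def)
  have pow: "cmod (f w ^ n) powr t = cmod (f w) powr s" for f :: "complex \<Rightarrow> complex" and w
  proof (cases "f w = 0")
    case False
    then show ?thesis
      using n by (simp add: norm_power powr_realpow[symmetric] powr_powr t_def)
  qed (use n in simp)
  show ?thesis
  proof (rule that)
    fix f z and R :: real
    assume "f holomorphic_on ball z R" "0 < R"
    then show "ennreal (R\<^sup>2 * cmod (f z) powr s)
      \<le> ennreal (256 * 4 powr ((1 - t) / t)) * (\<integral>\<^sup>+w\<in>ball z R. ennreal (cmod (f w) powr s) \<partial>lborel)"
      using norm_powr_le_area_integral_small[OF t, of "\<lambda>w. f w ^ n" z R]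
      by (simp only: pow) (auto intro: holomorphic_intros)
  qed simp
qed


section \<open>The weighted area measure on the half plane\<close>

lemma space_bergman_measure [simp]: "space (bergman_measure \<alpha>) = upper_half_plane"
  by (simp add: bergman_measure_def space_restrict_space)

lemma open_upper_half_plane: "open upper_half_plane"
  unfolding upper_half_plane_def by (rule open_halfspace_Im_gt)

lemma upper_half_plane_borel [measurable]: "upper_half_plane \<in> sets borel"
  using open_upper_half_plane by simp

lemma sets_bergman_measure: "sets (bergman_measure \<alpha>) = sets (restrict_space borel upper_half_plane)"
  by (simp add: bergman_measure_def cong: sets_restrict_space_cong)

lemma borel_measurable_bergman_iff:
  fixes g :: "complex \<Rightarrow> ennreal"
  shows "g \<in> borel_measurable (bergman_measure \<alpha>) \<longleftrightarrow> (\<lambda>z. g z * indicator upper_half_plane z) \<in> borel_measurable borel"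
  by (simp add: borel_measurable_restrict_space_iff_ennreal[symmetric]
      measurable_cong_sets[OF sets_bergman_measure refl])

lemma nn_integral_bergman:
  assumes "g \<in> borel_measurable (bergman_measure \<alpha>)"
  shows "(\<integral>\<^sup>+z. g z \<partial>bergman_measure \<alpha>) =
    (\<integral>\<^sup>+z. ennreal (1 / pi * (\<alpha> + 1) * (2 * Im z) powr \<alpha>) * (g z * indicator upper_half_plane z) \<partial>lborel)"
proof -
  have "g \<in> borel_measurable (restrict_space lborel upper_half_plane)"
    using assms by (simp add: bergman_measure_def)
  then show ?thesis
    unfolding bergman_measure_def
    by (subst nn_integral_density)
       (auto simp: nn_integral_restrict_space mult.assoc intro!: measurable_restrict_space1)
qed

lemma bounded_interval_endpoints:
  assumes "bounded_interval I"
  obtains a b where "a < b" "{a<..<b} \<subseteq> I" "I \<subseteq> {a..b}" "interval_length I = b - a" "I \<in> sets borel"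
proof -
  have int: "is_interval I" and bdd: "bounded I" and pos: "0 < interval_length I"
    using assms by (auto simp: bounded_interval_def)
  have ne: "I \<noteq> {}"
    using pos by auto
  define a b where "a = Inf I" and "b = Sup I"
  have below: "bdd_below I" and above: "bdd_above I"
    using bdd by (auto simp: bounded_imp_bdd_below bounded_imp_bdd_above)
  have sub: "I \<subseteq> {a..b}"
    unfolding a_def b_def using cInf_lower[OF _ below] cSup_upper[OF _ above] by auto
  have sup: "{a<..<b} \<subseteq> I"
  proof
    fix x assume "x \<in> {a<..<b}"
    then obtain l r where "l \<in> I" "l < x" "r \<in> I" "x < r"
      unfolding a_def b_def using cInf_lessD[OF ne, of x] less_cSupD[OF ne, of x] by fastforce
    then show "x \<in> I"
      using int unfolding is_interval_1 by (meson less_imp_le)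
  qed
  have "I = {a<..<b} \<union> (I \<inter> {a, b})"
    using sub sup by fastforce
  then have meas: "I \<in> sets borel"
    by (metis borel_open finite.emptyI finite.insertI finite_Int finite_imp_closed borel_closed
        open_greaterThanLessThan sets.Un)
  have "a \<le> b"
    using ne sub by fastforce
  have "interval_length I \<le> measure lborel {a..b}"
    using sub meas by (intro measure_mono_fmeasurable) (auto simp: fmeasurable_def emeasure_lborel_Icc_eq)
  moreover have "measure lborel {a<..<b} \<le> interval_length I"
  proof (rule measure_mono_fmeasurable)
    show "I \<in> fmeasurable lborel"
      using meas bdd emeasure_bounded_finite[OF bdd] by (auto simp: fmeasurable_def)
  qed (use sup in auto)
  ultimately have "interval_length I = b - a"
    using \<open>a \<le> b\<close> by simp
  then show ?thesis
    using that[of a b] sub sup meas pos by simp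
qed

lemma bounded_interval_open: "a < b \<Longrightarrow> bounded_interval {a<..<b}"
  by (auto simp: bounded_interval_def is_interval_1)

lemma sets_carleson_box:
  assumes "bounded_interval I"
  shows "carleson_box I \<in> sets borel"
proof -
  obtain a b where [measurable]: "I \<in> sets borel"
    using bounded_interval_endpoints[OF assms] by metis
  show ?thesis
    unfolding carleson_box_def upper_half_plane_def by measurable
qed

lemma carleson_box_in_sets_bergman:
  assumes "bounded_interval I"
  shows "carleson_box I \<in> sets (bergman_measure \<alpha>)"
  using sets_carleson_box[OF assms] unfolding sets_bergman_measure
  by (auto simp: sets_restrict_space carleson_box_def intro!: image_eqI[of _ _ "carleson_box I"])

lemma bergman_measure_carleson_box:
  assumes I: "bounded_interval I" and \<alpha>: "-1 < \<alpha>"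
  shows "emeasure (bergman_measure \<alpha>) (carleson_box I)
    = ennreal (2 powr \<alpha> / pi * interval_length I powr (\<alpha> + 2))"
proof -
  define L where "L = interval_length I"
  obtain a b where ab: "a < b" "{a<..<b} \<subseteq> I" "I \<subseteq> {a..b}" "L = b - a" and [measurable]: "I \<in> sets borel"
    using bounded_interval_endpoints[OF I] unfolding L_def by metis
  have L: "0 < L"
    using ab by simp
  have "bounded I"
    using I by (simp add: bounded_interval_def)
  then have emeas_I: "emeasure lborel I = ennreal L"
    unfolding L_def by (intro emeasure_eq_ennreal_measure) (use emeasure_bounded_finite in force)
  have [measurable]: "carleson_box I \<in> sets borel"
    by (rule sets_carleson_box[OF I])
  define c where "c = 1 / pi * (\<alpha> + 1) * 2 powr \<alpha>"
  have c: "0 \<le> c"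
    using \<alpha> by (simp add: c_def)
  let ?w = "\<lambda>y. ennreal (c * y powr \<alpha>) * indicator {0<..<L} y"
  have "emeasure (bergman_measure \<alpha>) (carleson_box I)
      = (\<integral>\<^sup>+z. indicator (carleson_box I) z \<partial>bergman_measure \<alpha>)"
    by (intro nn_integral_indicator[symmetric] carleson_box_in_sets_bergman I)
  also have "\<dots> = (\<integral>\<^sup>+z. ?w (Im z) * indicator I (Re z) \<partial>lborel)"
  proof (subst nn_integral_bergman)
    show "(indicator (carleson_box I) :: complex \<Rightarrow> ennreal) \<in> borel_measurable (bergman_measure \<alpha>)"
      unfolding borel_measurable_bergman_iff by measurable
    show "(\<integral>\<^sup>+z. ennreal (1 / pi * (\<alpha> + 1) * (2 * Im z) powr \<alpha>)
          * (indicator (carleson_box I) z * indicator upper_half_plane z) \<partial>lborel)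
        = (\<integral>\<^sup>+z. ?w (Im z) * indicator I (Re z) \<partial>lborel)"
      by (intro nn_integral_cong)
         (auto simp: indicator_def carleson_box_def upper_half_plane_def L_def c_def powr_mult mult.assoc)
  qed
  also have "\<dots> = (\<integral>\<^sup>+y. \<integral>\<^sup>+x. ?w y * indicator I x \<partial>lborel \<partial>lborel)"
    by (subst nn_integral_complex_iterated(2)) auto
  also have "\<dots> = (\<integral>\<^sup>+y. ?w y * ennreal L \<partial>lborel)"
    by (subst nn_integral_cmult_indicator) (auto simp: emeas_I)
  also have "\<dots> = (\<integral>\<^sup>+y. ennreal (c * L * y powr \<alpha>) * indicator {0..L} y \<partial>lborel)"
  proof (rule nn_integral_cong_AE)
    \<comment> \<open>the end point \<open>L\<close> is outside the box but inside the interval of integration\<close>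
    have "AE y in lborel. y \<noteq> L"
      by (rule AE_lborel_singleton)
    then show "AE y in lborel. ?w y * ennreal L = ennreal (c * L * y powr \<alpha>) * indicator {0..L} y"
      by eventually_elim (use L c in \<open>auto simp: indicator_def ennreal_mult[symmetric] mult_ac\<close>)
  qed
  also have "\<dots> = ennreal (c * L * (L powr (\<alpha> + 1) / (\<alpha> + 1)))"
    using has_integral_mult_right[OF has_integral_powr_from_0[OF \<alpha>, of L], of "c * L"] L c
    by (intro nn_integral_has_integral_lebesgue') auto
  also have "c * L * (L powr (\<alpha> + 1) / (\<alpha> + 1)) = 2 powr \<alpha> / pi * (L * L powr (\<alpha> + 1))"
    using \<alpha> by (simp add: c_def)
  also have "L * L powr (\<alpha> + 1) = L powr (\<alpha> + 2)"
    using L powr_add[of L 1 "\<alpha> + 1"] by (simp add: add.commute)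
  finally show ?thesis
    by (simp add: L_def)
qed

lemma norm_powr_measurable_bergman:
  fixes s :: real
  assumes "f holomorphic_on upper_half_plane"
  shows "(\<lambda>z. ennreal (cmod (f z) powr s)) \<in> borel_measurable (bergman_measure \<alpha>)"
  unfolding borel_measurable_bergman_iff using assms
  by (intro borel_measurable_norm_powr_indicator holomorphic_on_imp_continuous_on open_upper_half_plane) auto

lemma Im_in_half_ball:
  assumes "w \<in> ball z (Im z / 2)"
  shows "Im z / 2 \<le> Im w" "Im w \<le> 3 * Im z / 2"
  using assms abs_Im_le_cmod[of "z - w"] by (auto simp: dist_norm)

text \<open>On the disc with centre \<open>z\<close> and radius \<open>Im z / 2\<close> the height varies by a factor of at most 3,
  so the weight is comparable to \<open>Im z powr \<alpha>\<close> and the unweighted estimate carries over. The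
  exponent \<open>\<alpha> + 2\<close> is that of the measure of this disc.\<close>

lemma norm_powr_le_bergman_integral:
  fixes s \<alpha> :: real
  assumes s: "0 < s" and \<alpha>: "-1 < \<alpha>"
  obtains K where "0 < K" and "\<And>f z E. f holomorphic_on upper_half_plane \<Longrightarrow> z \<in> upper_half_plane \<Longrightarrow>
    ball z (Im z / 2) \<subseteq> E \<Longrightarrow>
    ennreal (Im z powr (\<alpha> + 2) * cmod (f z) powr s)
    \<le> ennreal K * (\<integral>\<^sup>+w\<in>E. ennreal (cmod (f w) powr s) \<partial>bergman_measure \<alpha>)"
proof -
  obtain K where K: "0 < K" and mean: "\<And>f z R. f holomorphic_on ball z R \<Longrightarrow> 0 < R \<Longrightarrow>
      ennreal (R\<^sup>2 * cmod (f z) powr s) \<le> ennreal K * (\<integral>\<^sup>+w\<in>ball z R. ennreal (cmod (f w) powr s) \<partial>lborel)"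
    using norm_powr_le_area_integral[OF s] by blast
  define c where "c = 1 / pi * (\<alpha> + 1) * min 1 (3 powr \<alpha>)"
  have c: "0 < c"
    using \<alpha> by (simp add: c_def)
  show ?thesis
  proof (rule that)
    show "0 < 4 / c * K"
      using c K by simp
  next
    fix f z E
    assume holo: "f holomorphic_on upper_half_plane" and z: "z \<in> upper_half_plane"
      and E: "ball z (Im z / 2) \<subseteq> E"
    define y B where "y = Im z" and "B = ball z (Im z / 2)"
    have y: "0 < y"
      using z by (simp add: y_def upper_half_plane_def)
    have strip: "y \<le> 2 * Im w" "2 * Im w \<le> 3 * y" if "w \<in> B" for w
      using Im_in_half_ball[of w z] that by (auto simp: B_def y_def)
    have BH: "B \<subseteq> upper_half_plane"
      using strip y unfolding upper_half_plane_def by fastforce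
    have fB: "f holomorphic_on B"
      by (rule holomorphic_on_subset[OF holo BH])
    have weight: "c * y powr \<alpha> \<le> 1 / pi * (\<alpha> + 1) * (2 * Im w) powr \<alpha>" if w: "w \<in> B" for w
    proof -
      define \<tau> where "\<tau> = 2 * Im w / y"
      have \<tau>: "1 \<le> \<tau>" "\<tau> \<le> 3"
        using strip[OF w] y by (auto simp: \<tau>_def field_simps)
      have "min 1 (3 powr \<alpha>) \<le> \<tau> powr \<alpha>"
      proof (cases "0 \<le> \<alpha>")
        case True
        then show ?thesis
          using powr_mono2[of \<alpha> 1 \<tau>] \<tau> by (simp add: min_le_iff_disj)
      next
        case False
        then show ?thesis
          using powr_mono2'[of \<alpha> \<tau> 3] \<tau> by (simp add: min_le_iff_disj)
      qed
      then have "min 1 (3 powr \<alpha>) * y powr \<alpha> \<le> \<tau> powr \<alpha> * y powr \<alpha>"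
        by (rule mult_right_mono) simp
      also have "\<dots> = (2 * Im w) powr \<alpha>"
        using y \<tau> by (simp add: powr_mult[symmetric] \<tau>_def)
      finally have "1 / pi * (\<alpha> + 1) * (min 1 (3 powr \<alpha>) * y powr \<alpha>) \<le> 1 / pi * (\<alpha> + 1) * (2 * Im w) powr \<alpha>"
        using \<alpha> by (intro mult_left_mono) auto
      then show ?thesis
        by (simp add: c_def mult.assoc)
    qed
    define T where "T = (\<integral>\<^sup>+w\<in>B. ennreal (cmod (f w) powr s) \<partial>lborel)"
    have measB: "(\<lambda>w. ennreal (cmod (f w) powr s) * indicator B w) \<in> borel_measurable borel"
      unfolding B_def using fB[unfolded B_def] s
      by (intro borel_measurable_norm_powr_indicator holomorphic_on_imp_continuous_on) auto
    have "ennreal (c * y powr \<alpha>) * T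
        = (\<integral>\<^sup>+w. ennreal (c * y powr \<alpha>) * (ennreal (cmod (f w) powr s) * indicator B w) \<partial>lborel)"
      unfolding T_def using measB by (subst nn_integral_cmult) auto
    also have "\<dots> \<le> (\<integral>\<^sup>+w. ennreal (1 / pi * (\<alpha> + 1) * (2 * Im w) powr \<alpha>)
        * ((ennreal (cmod (f w) powr s) * indicator B w) * indicator upper_half_plane w) \<partial>lborel)"
      using weight BH by (intro nn_integral_mono) (auto simp: indicator_def intro!: mult_right_mono ennreal_leI)
    also have "\<dots> = (\<integral>\<^sup>+w\<in>B. ennreal (cmod (f w) powr s) \<partial>bergman_measure \<alpha>)"
      using measB by (subst nn_integral_bergman) (auto simp: borel_measurable_bergman_iff)
    also have "\<dots> \<le> (\<integral>\<^sup>+w\<in>E. ennreal (cmod (f w) powr s) \<partial>bergman_measure \<alpha>)"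
      using E by (intro nn_integral_mono) (auto simp: indicator_def B_def)
    finally have le: "ennreal (c * y powr \<alpha>) * T \<le> (\<integral>\<^sup>+w\<in>E. ennreal (cmod (f w) powr s) \<partial>bergman_measure \<alpha>)" .
    define A W where "A = 4 / c" and "W = c * y powr \<alpha>"
    have AW: "0 \<le> A" "0 \<le> W"
      using c by (auto simp: A_def W_def)
    have "y powr (\<alpha> + 2) = y powr \<alpha> * y\<^sup>2"
      using y by (simp add: powr_add)
    then have "y powr (\<alpha> + 2) * cmod (f z) powr s = (A * W) * ((y / 2)\<^sup>2 * cmod (f z) powr s)"
      using c by (simp add: power2_eq_square A_def W_def)
    also have "ennreal \<dots> = ennreal (A * W) * ennreal ((y / 2)\<^sup>2 * cmod (f z) powr s)"
      using AW by (intro ennreal_mult) auto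
    also have "\<dots> \<le> ennreal (A * W) * (ennreal K * T)"
      unfolding T_def using mean[of f z "y / 2"] fB y
      by (intro mult_left_mono) (auto simp: B_def y_def)
    also have "\<dots> = ennreal (A * K) * (ennreal W * T)"
      using AW K by (simp add: ennreal_mult mult_ac)
    also have "\<dots> \<le> ennreal (4 / c * K) * (\<integral>\<^sup>+w\<in>E. ennreal (cmod (f w) powr s) \<partial>bergman_measure \<alpha>)"
      using le unfolding A_def W_def by (rule mult_left_mono) simp
    finally show "ennreal (Im z powr (\<alpha> + 2) * cmod (f z) powr s)
      \<le> ennreal (4 / c * K) * (\<integral>\<^sup>+w\<in>E. ennreal (cmod (f w) powr s) \<partial>bergman_measure \<alpha>)"
      by (simp only: y_def)
  qed
qed


section \<open>The pullback measure is a Carleson measure\<close>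

lemma epowr_mono:
  assumes "x \<le> y" "0 \<le> a"
  shows "epowr x a \<le> epowr y a"
proof (cases y)
  case (real r)
  then obtain t where "x = ennreal t" "0 \<le> t" "t \<le> r"
    using assms by (cases x) (auto simp: top_unique)
  then show ?thesis
    using real assms by (auto simp: epowr_def intro!: ennreal_leI powr_mono2)
qed (simp add: epowr_def)

lemma epowr_ennreal: "0 < x \<Longrightarrow> epowr (ennreal x) a = ennreal (x powr a)"
  by (simp add: epowr_def)

lemma epowr_ennreal': "0 \<le> x \<Longrightarrow> a \<noteq> 0 \<Longrightarrow> epowr (ennreal x) a = ennreal (x powr a)"
  by (simp add: epowr_def)

lemma epowr_cmult:
  assumes "0 < c"
  shows "epowr (ennreal c * x) a = ennreal (c powr a) * epowr x a"
proof (cases x)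
  case (real r)
  then show ?thesis
    using assms by (auto simp: epowr_def ennreal_mult[symmetric] powr_mult)
next
  case top
  then show ?thesis
    using assms by (auto simp: epowr_def ennreal_mult_top)
qed

lemma epowr_epowr_inverse: "0 < a \<Longrightarrow> epowr (epowr x (1 / a)) a = x"
  by (cases x) (auto simp: epowr_def powr_powr)

text \<open>This holds for \<open>\<gamma> = 1\<close> and for \<open>x = \<infinity>\<close> too, because then one factor is 1 or both are \<open>\<infinity>\<close>.\<close>

lemma epowr_conjugate_mult:
  assumes "1 \<le> \<gamma>"
  shows "epowr x (1 - 1 / \<gamma>) * epowr x (1 / \<gamma>) = x"
proof (cases x)
  case (real r)
  then show ?thesis
    using assms by (auto simp: epowr_def ennreal_mult[symmetric] powr_add[symmetric])
next
  case top
  then show ?thesis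
    using assms by (auto simp: epowr_def)
qed

text \<open>The half plane is exhausted by the Carleson boxes over the intervals with centre \<open>a\<close> and
  half length \<open>2 ^ n * L\<close>. A point that enters at stage \<open>n\<close> has distance at least
  \<open>2 ^ n * L / 2\<close> from \<open>Complex a (- L)\<close>, and the box has measure of order
  \<open>(2 ^ n * L) powr (\<alpha> + 2)\<close>. Since \<open>m \<ge> \<alpha> + 3\<close>, the stages sum like a geometric series of
  ratio at most \<open>1 / 2\<close>.\<close>

lemma shifted_power_bergman_integral_le:
  fixes \<alpha> m a L :: real
  assumes \<alpha>: "-1 < \<alpha>" and m: "\<alpha> + 3 \<le> m" and L: "0 < L"
  shows "(\<integral>\<^sup>+z. ennreal (cmod (z - Complex a (- L)) powr (- m)) \<partial>bergman_measure \<alpha>)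
    \<le> ennreal (2 powr (m + 2 * \<alpha> + 3) / pi * L powr (\<alpha> + 2 - m))"
proof -
  define I where "I = (\<lambda>n. {a - 2 ^ n * L <..< a + 2 ^ n * L})"
  have I: "bounded_interval (I n)" and len: "interval_length (I n) = 2 * (2 ^ n * L)" for n
    using L by (auto simp: I_def intro!: bounded_interval_open)
  define v where "v = (\<lambda>n. (2 ^ n * L / 2) powr (- m))"
  define c where "c = 2 powr (m + 2 * \<alpha> + 2) / pi * L powr (\<alpha> + 2 - m)"
  have meas: "(\<lambda>z. ennreal (v n) * indicator (carleson_box (I n)) z) \<in> borel_measurable (bergman_measure \<alpha>)" for n
    unfolding borel_measurable_bergman_iff using sets_carleson_box[OF I] by measurable
  have sets: "carleson_box (I n) \<in> sets (bergman_measure \<alpha>)" for n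
    by (rule carleson_box_in_sets_bergman[OF I])
  have "(\<integral>\<^sup>+z. ennreal (cmod (z - Complex a (- L)) powr (- m)) \<partial>bergman_measure \<alpha>)
      \<le> (\<integral>\<^sup>+z. (\<Sum>n. ennreal (v n) * indicator (carleson_box (I n)) z) \<partial>bergman_measure \<alpha>)"
  proof (rule nn_integral_mono)
    fix z assume "z \<in> space (bergman_measure \<alpha>)"
    then have z: "z \<in> upper_half_plane" "0 < Im z"
      by (auto simp: upper_half_plane_def)
    have in_box: "z \<in> carleson_box (I n) \<longleftrightarrow> \<bar>Re z - a\<bar> < 2 ^ n * L \<and> Im z < 2 * (2 ^ n * L)" for n
      unfolding carleson_box_def len using z by (auto simp: I_def)
    obtain n0 where "(\<bar>Re z - a\<bar> + Im z) / L < 2 ^ n0"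
      using real_arch_pow[of 2] by auto
    then have "\<bar>Re z - a\<bar> + Im z < 2 ^ n0 * L"
      using L by (simp add: field_simps)
    then have ex: "z \<in> carleson_box (I n0)"
      unfolding in_box using z by auto
    define n where "n = (LEAST n. z \<in> carleson_box (I n))"
    have n: "z \<in> carleson_box (I n)"
      unfolding n_def by (rule LeastI[of "\<lambda>n. z \<in> carleson_box (I n)", OF ex])
    have "2 ^ n * L / 2 \<le> cmod (z - Complex a (- L))"
    proof (cases n)
      case 0
      then show ?thesis
        using abs_Im_le_cmod[of "z - Complex a (- L)"] z L by simp
    next
      case (Suc j)
      then have "z \<notin> carleson_box (I j)"
        using not_less_Least[of j "\<lambda>n. z \<in> carleson_box (I n)"] by (simp add: n_def)
      then have "2 ^ j * L \<le> \<bar>Re z - a\<bar> \<or> 2 * (2 ^ j * L) \<le> Im z"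
        unfolding in_box by auto
      moreover have "0 < 2 ^ j * L"
        using L by simp
      ultimately have "2 ^ j * L \<le> \<bar>Re z - a\<bar> \<or> 2 ^ j * L \<le> \<bar>Im z + L\<bar>"
        using L z by auto
      then show ?thesis
        using Suc abs_Im_le_cmod[of "z - Complex a (- L)"] abs_Re_le_cmod[of "z - Complex a (- L)"]
        by auto
    qed
    then have "cmod (z - Complex a (- L)) powr (- m) \<le> v n"
      unfolding v_def using L \<alpha> m by (intro powr_mono2') auto
    then have "ennreal (cmod (z - Complex a (- L)) powr (- m))
        \<le> ennreal (v n) * indicator (carleson_box (I n)) z"
      using n by (simp add: ennreal_leI)
    also have "\<dots> \<le> (\<Sum>n. ennreal (v n) * indicator (carleson_box (I n)) z)"
      using sum_le_suminf[of "\<lambda>n. ennreal (v n) * indicator (carleson_box (I n)) z" "{n}"]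
      by (simp del: sum_mult_indicator)
    finally show "ennreal (cmod (z - Complex a (- L)) powr (- m))
        \<le> (\<Sum>n. ennreal (v n) * indicator (carleson_box (I n)) z)" .
  qed
  also have "\<dots> = (\<Sum>n. ennreal (v n) * emeasure (bergman_measure \<alpha>) (carleson_box (I n)))"
    using meas sets by (simp add: nn_integral_suminf nn_integral_cmult_indicator)
  also have "\<dots> \<le> (\<Sum>n. ennreal (c * (1 / 2) ^ n))"
  proof (rule suminf_le)
    fix n
    have pow: "(2::real) ^ n = 2 powr n"
      by (simp add: powr_realpow)
    have v: "v n = 2 powr (- m * (real n - 1)) * L powr (- m)"
    proof -
      have eq: "2 ^ n * L / 2 = 2 powr (real n - 1) * L"
        by (simp add: pow powr_diff)
      show ?thesis
        unfolding v_def eq using L by (simp add: powr_mult powr_powr mult.commute)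
    qed
    have box: "(2 * (2 ^ n * L)) powr (\<alpha> + 2) = 2 powr ((real n + 1) * (\<alpha> + 2)) * L powr (\<alpha> + 2)"
    proof -
      have eq: "2 * (2 ^ n * L) = 2 powr (real n + 1) * L"
        by (simp add: pow powr_add)
      show ?thesis
        unfolding eq using L by (simp add: powr_mult powr_powr)
    qed
    have "v n * (2 powr \<alpha> / pi * (2 * (2 ^ n * L)) powr (\<alpha> + 2))
        = (2 powr (- m * (real n - 1)) * 2 powr \<alpha> * 2 powr ((real n + 1) * (\<alpha> + 2))) / pi
          * (L powr (\<alpha> + 2) * L powr (- m))"
      unfolding v box by simp
    also have "\<dots> = 2 powr (m + 2 * \<alpha> + 2 + real n * (\<alpha> + 2 - m)) / pi * L powr (\<alpha> + 2 - m)"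
    proof -
      have "- m * (real n - 1) + \<alpha> + (real n + 1) * (\<alpha> + 2) = m + 2 * \<alpha> + 2 + real n * (\<alpha> + 2 - m)"
        by (simp add: algebra_simps)
      then show ?thesis
        by (simp only: powr_add[symmetric] diff_conv_add_uminus)
    qed
    also have "\<dots> = c * 2 powr (real n * (\<alpha> + 2 - m))"
      by (simp add: c_def powr_add)
    also have "\<dots> \<le> c * 2 powr (- real n)"
    proof (intro mult_left_mono powr_mono)
      have "real n * (\<alpha> + 2 - m) \<le> real n * (- 1)"
        using m by (intro mult_left_mono) auto
      then show "real n * (\<alpha> + 2 - m) \<le> - real n"
        by simp
    qed (auto simp: c_def)
    also have "\<dots> = c * (1 / 2) ^ n"
      by (simp add: powr_minus powr_realpow power_one_over inverse_eq_divide)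
    finally show "ennreal (v n) * emeasure (bergman_measure \<alpha>) (carleson_box (I n)) \<le> ennreal (c * (1 / 2) ^ n)"
      unfolding bergman_measure_carleson_box[OF I \<alpha>] len
      by (subst ennreal_mult[symmetric]) (auto simp: v_def intro!: ennreal_leI)
  qed auto
  also have "\<dots> = ennreal (c * 2)"
    using sums_mult[OF geometric_sums[of "1 / 2 :: real"], of c]
    by (intro suminf_ennreal_eq) (auto simp: c_def)
  also have "c * 2 = 2 powr (m + 2 * \<alpha> + 3) / pi * L powr (\<alpha> + 2 - m)"
    by (simp add: c_def powr_add)
  finally show ?thesis .
qed

lemma weighted_comp_holomorphic:
  assumes "u holomorphic_on upper_half_plane" "\<phi> holomorphic_on upper_half_plane"
    and "\<phi> ` upper_half_plane \<subseteq> upper_half_plane" "f holomorphic_on upper_half_plane"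
  shows "weighted_comp u \<phi> f holomorphic_on upper_half_plane"
proof -
  have "(\<lambda>z. f (\<phi> z)) holomorphic_on upper_half_plane"
    using holomorphic_on_compose_gen[OF assms(2,4), unfolded o_def] assms(3) by blast
  then show ?thesis
    unfolding weighted_comp_def[abs_def] using assms(1) by (intro holomorphic_on_mult)
qed

text \<open>Necessity of the Carleson condition: boundedness is tested on
  \<open>f z = inverse ((z - w) ^ k)\<close>, where \<open>w = Complex a (- L)\<close> is the reflection in the real axis of a
  corner of the box. On the box \<open>cmod f\<close> is at least \<open>(3 * L) powr (- k)\<close>, and for large \<open>k\<close> the
  norm of \<open>f\<close> is, up to a constant, that of a function of size \<open>L powr (- k)\<close> supported on the box.\<close>

lemma pullback_measure_carleson_box_le:
  fixes p q \<alpha> :: real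
  assumes p: "1 \<le> p" and q: "p \<le> q" and \<alpha>: "-1 < \<alpha>"
    and u: "u holomorphic_on upper_half_plane" and \<phi>: "\<phi> holomorphic_on upper_half_plane"
    and maps: "\<phi> ` upper_half_plane \<subseteq> upper_half_plane"
    and bdd: "weighted_comp_bounded p q \<alpha> u \<phi>"
  obtains C where "0 < C" and "\<And>I. bounded_interval I \<Longrightarrow>
    pullback_measure u \<phi> q \<alpha> (carleson_box I) \<le> ennreal (C * interval_length I powr ((\<alpha> + 2) * q / p))"
proof -
  obtain C0 where C0: "0 \<le> C0" and bound: "\<And>f. f \<in> bergman_space p \<alpha> \<Longrightarrow>
      bergman_norm q \<alpha> (weighted_comp u \<phi> f) \<le> ennreal C0 * bergman_norm p \<alpha> f"
    using bdd unfolding weighted_comp_bounded_def by blast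
  \<comment> \<open>since \<open>p \<ge> 1\<close>, this \<open>k\<close> makes \<open>k * p\<close> large enough for the norm estimate\<close>
  define k where "k = nat \<lceil>\<alpha> + 3\<rceil>"
  define m where "m = k * p"
  have "\<alpha> + 3 \<le> k"
    using \<alpha> by (simp add: k_def)
  also have "real k * 1 \<le> m"
    unfolding m_def using p by (intro mult_left_mono) auto
  finally have m: "\<alpha> + 3 \<le> m"
    by simp
  define B where "B = 2 powr (m + 2 * \<alpha> + 3) / pi"
  have B: "0 < B"
    by (simp add: B_def)
  define C where "C = 3 powr (k * q) * ((C0 + 1) * B powr (1 / p)) powr q"
  have pq: "0 < p" "0 < q"
    using p q by auto
  show ?thesis
  proof (rule that)
    show "0 < C"
      using B C0 by (simp add: C_def)
  next
    fix I assume I: "bounded_interval I"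
    define L where "L = interval_length I"
    obtain a b where ab: "a < b" "I \<subseteq> {a..b}" "L = b - a"
      using bounded_interval_endpoints[OF I] unfolding L_def by metis
    then have L: "0 < L"
      by simp
    define w where "w = Complex a (- L)"
    define f where "f = (\<lambda>z. inverse ((z - w) ^ k))"
    have nz: "z - w \<noteq> 0" if "z \<in> upper_half_plane" for z
      using that L by (auto simp: upper_half_plane_def w_def complex_eq_iff)
    have holo: "f holomorphic_on upper_half_plane"
      unfolding f_def using nz by (intro holomorphic_intros) auto
    have f_pow: "cmod (f z) powr s = cmod (z - w) powr (- (k * s))" if "z \<in> upper_half_plane" for z and s :: real
      using nz[OF that] by (simp add: f_def norm_inverse norm_power powr_realpow[symmetric] powr_minus[symmetric] powr_powr)
    have "(\<integral>\<^sup>+z. ennreal (cmod (f z) powr p) \<partial>bergman_measure \<alpha>)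
        = (\<integral>\<^sup>+z. ennreal (cmod (z - w) powr (- m)) \<partial>bergman_measure \<alpha>)"
      unfolding m_def
    proof (rule nn_integral_cong)
      fix z assume "z \<in> space (bergman_measure \<alpha>)"
      then show "ennreal (cmod (f z) powr p) = ennreal (cmod (z - w) powr - (k * p))"
        using f_pow[of z p] by simp
    qed
    also have "\<dots> \<le> ennreal (B * L powr (\<alpha> + 2 - m))"
      unfolding w_def B_def by (rule shifted_power_bergman_integral_le[OF \<alpha> m L])
    finally have norm_f: "bergman_norm p \<alpha> f \<le> ennreal ((B * L powr (\<alpha> + 2 - m)) powr (1 / p))"
      unfolding bergman_norm_def using B L pq
      by (subst epowr_ennreal[symmetric]) (auto intro!: epowr_mono)
    then have f_in: "f \<in> bergman_space p \<alpha>"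
      using holo by (auto simp: bergman_space_def less_top[symmetric] top_unique)
    define T where "T = (\<integral>\<^sup>+z. ennreal (cmod (weighted_comp u \<phi> f z) powr q) \<partial>bergman_measure \<alpha>)"
    have "bergman_norm q \<alpha> (weighted_comp u \<phi> f) \<le> ennreal C0 * bergman_norm p \<alpha> f"
      by (rule bound[OF f_in])
    also have "\<dots> \<le> ennreal (C0 + 1) * ennreal ((B * L powr (\<alpha> + 2 - m)) powr (1 / p))"
      using norm_f by (intro mult_mono ennreal_leI) auto
    also have "\<dots> = ennreal ((C0 + 1) * (B * L powr (\<alpha> + 2 - m)) powr (1 / p))"
      using C0 by (intro ennreal_mult[symmetric]) auto
    finally have "epowr (bergman_norm q \<alpha> (weighted_comp u \<phi> f)) q
        \<le> epowr (ennreal ((C0 + 1) * (B * L powr (\<alpha> + 2 - m)) powr (1 / p))) q"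
      using pq by (intro epowr_mono) auto
    then have T: "T \<le> ennreal (((C0 + 1) * (B * L powr (\<alpha> + 2 - m)) powr (1 / p)) powr q)"
      using C0 B L pq by (simp add: bergman_norm_def epowr_epowr_inverse epowr_ennreal T_def)
    have box: "cmod (v - w) powr - (k * q) \<ge> (3 * L) powr - (k * q)" if v: "v \<in> carleson_box I" for v
    proof (rule powr_mono2')
      have "\<bar>Re (v - w)\<bar> \<le> L" "\<bar>Im (v - w)\<bar> \<le> 2 * L"
        using v ab by (auto simp: carleson_box_def w_def L_def upper_half_plane_def)
      then show "cmod (v - w) \<le> 3 * L"
        using cmod_le[of "v - w"] by linarith
      show "0 < cmod (v - w)"
        using nz v by (auto simp: carleson_box_def)
    qed (use pq in auto)
    have "pullback_measure u \<phi> q \<alpha> (carleson_box I)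
        \<le> (\<integral>\<^sup>+z. ennreal ((3 * L) powr (k * q)) * ennreal (cmod (weighted_comp u \<phi> f z) powr q) \<partial>bergman_measure \<alpha>)"
      unfolding pullback_measure_def
    proof (rule nn_integral_mono)
      fix z
      show "ennreal (cmod (u z) powr q) * indicator (\<phi> -` carleson_box I \<inter> upper_half_plane) z
          \<le> ennreal ((3 * L) powr (k * q)) * ennreal (cmod (weighted_comp u \<phi> f z) powr q)"
      proof (cases "z \<in> \<phi> -` carleson_box I \<inter> upper_half_plane")
        case True
        then have \<phi>z: "\<phi> z \<in> carleson_box I" "\<phi> z \<in> upper_half_plane"
          by (auto simp: carleson_box_def)
        have "1 = (3 * L) powr (k * q) * (3 * L) powr - (k * q)"
          using L by (simp add: powr_add[symmetric])
        also have "\<dots> \<le> (3 * L) powr (k * q) * cmod (f (\<phi> z)) powr q"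
          unfolding f_pow[OF \<phi>z(2)] using box[OF \<phi>z(1)] by (intro mult_left_mono) auto
        finally have "cmod (u z) powr q * 1 \<le> cmod (u z) powr q * ((3 * L) powr (k * q) * cmod (f (\<phi> z)) powr q)"
          by (rule mult_left_mono) simp
        then show ?thesis
          using True by (simp add: ennreal_mult[symmetric] weighted_comp_def norm_mult powr_mult mult_ac ennreal_leI)
      qed simp
    qed
    also have "\<dots> = ennreal ((3 * L) powr (k * q)) * T"
      unfolding T_def using weighted_comp_holomorphic[OF u \<phi> maps holo] pq
      by (intro nn_integral_cmult norm_powr_measurable_bergman) auto
    also have "\<dots> \<le> ennreal ((3 * L) powr (k * q)) * ennreal (((C0 + 1) * (B * L powr (\<alpha> + 2 - m)) powr (1 / p)) powr q)"
      using T by (rule mult_left_mono) simp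
    also have "\<dots> = ennreal ((3 * L) powr (k * q) * (((C0 + 1) * (B * L powr (\<alpha> + 2 - m)) powr (1 / p)) powr q))"
      by (intro ennreal_mult[symmetric]) auto
    also have "(3 * L) powr (k * q) * (((C0 + 1) * (B * L powr (\<alpha> + 2 - m)) powr (1 / p)) powr q)
        = C * (L powr (k * q) * L powr ((\<alpha> + 2 - m) * (1 / p) * q))"
      using L B C0 by (simp add: C_def powr_mult powr_powr mult_ac)
    also have "L powr (k * q) * L powr ((\<alpha> + 2 - m) * (1 / p) * q) = L powr ((\<alpha> + 2) * q / p)"
    proof -
      have "k * q + (\<alpha> + 2 - m) * (1 / p) * q = (\<alpha> + 2) * q / p"
        using pq by (simp add: m_def field_simps)
      then show ?thesis
        by (simp only: powr_add[symmetric])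
    qed
    finally show "pullback_measure u \<phi> q \<alpha> (carleson_box I)
        \<le> ennreal (C * interval_length I powr ((\<alpha> + 2) * q / p))"
      by (simp add: L_def)
  qed
qed


section \<open>Domination by a sum over three dyadic grids\<close>

lemma countable_dyadic_grid:
  assumes "dyadic_grid D"
  shows "countable D"
proof -
  have level: "countable {I \<in> D. interval_length I = 2 powi k}" for k :: int
  proof (rule countable_disjoint_nonempty_interior_subsets)
    show "pairwise disjnt {I \<in> D. interval_length I = 2 powi k}"
      using assms by (auto simp: dyadic_grid_def partition_on_def disjoint_def pairwise_def disjnt_def)
  next
    fix I assume "I \<in> {I \<in> D. interval_length I = 2 powi k}" "interior I = {}"
    then have "bounded_interval I"
      using assms by (auto simp: dyadic_grid_def)
    then obtain a b where "a < b" "{a<..<b} \<subseteq> I"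
      by (rule bounded_interval_endpoints)
    then have "{a<..<b} \<subseteq> interior I" "(a + b) / 2 \<in> {a<..<b}"
      using interior_maximal[of "{a<..<b}" I] by auto
    with \<open>interior I = {}\<close> show "I = {}"
      by blast
  qed
  have "D \<subseteq> (\<Union>k::int. {I \<in> D. interval_length I = 2 powi k})"
    using assms by (auto simp: dyadic_grid_def)
  then show ?thesis
    by (rule countable_subset) (intro countable_UN level countableI_type)
qed

text \<open>The interval with centre \<open>Re z\<close> and half length \<open>2 * Im z\<close> lies in a dyadic one of
  length between \<open>4 * Im z\<close> and \<open>12 * Im z\<close>. Then \<open>z\<close> stays away from the boundary of the box by
  a multiple of \<open>Im z\<close>, and yet the box is not much larger than that.\<close>

lemma dyadic_box_around_point:
  assumes grid: "\<And>i. i \<in> {1..3} \<Longrightarrow> dyadic_grid (D i)"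
    and cover: "\<And>I. bounded_interval I \<Longrightarrow>
      \<exists>i\<in>{1..3}. \<exists>J\<in>D i. I \<subseteq> J \<and> interval_length J \<le> 3 * interval_length I"
    and z: "z \<in> upper_half_plane"
  obtains i J where "i \<in> {1..3::nat}" "J \<in> D i" "bounded_interval J"
    "ball z (Im z / 2) \<subseteq> carleson_box J" "interval_length J \<le> 12 * Im z"
proof -
  define y where "y = Im z"
  have y: "0 < y"
    using z by (simp add: y_def upper_half_plane_def)
  define I where "I = {Re z - 2 * y <..< Re z + 2 * y}"
  have I: "bounded_interval I" "interval_length I = 4 * y"
    using y by (auto simp: I_def intro!: bounded_interval_open)
  then obtain i J where iJ: "i \<in> {1..3::nat}" "J \<in> D i" "I \<subseteq> J" "interval_length J \<le> 3 * (4 * y)"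
    using cover[OF I(1)] by auto
  have J: "bounded_interval J"
    using grid[OF iJ(1)] iJ(2) by (auto simp: dyadic_grid_def)
  obtain a b where ab: "J \<subseteq> {a..b}" "interval_length J = b - a"
    using bounded_interval_endpoints[OF J] by metis
  have "{Re z - 2 * y .. Re z + 2 * y} = closure I"
    using y by (simp add: I_def)
  also have "\<dots> \<subseteq> {a..b}"
    using iJ(3) ab by (intro closure_minimal) auto
  finally have long: "4 * y \<le> interval_length J"
    using ab y by auto
  have "ball z (y / 2) \<subseteq> carleson_box J"
  proof
    fix w assume w: "w \<in> ball z (y / 2)"
    have "\<bar>Re z - Re w\<bar> < y / 2"
      using w abs_Re_le_cmod[of "z - w"] by (simp add: dist_norm)
    then have "Re w \<in> I"
      unfolding I_def greaterThanLessThan_iff using y by linarith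
    then have "Re w \<in> J"
      using iJ(3) by blast
    moreover have "y / 2 \<le> Im w" "Im w \<le> 3 * y / 2"
      using Im_in_half_ball[of w z] w by (auto simp: y_def)
    ultimately show "w \<in> carleson_box J"
      using long y by (auto simp: carleson_box_def upper_half_plane_def)
  qed
  then show ?thesis
    using that[OF iJ(1,2) J] iJ(4) by (simp add: y_def)
qed

text \<open>The power mean of order \<open>\<gamma>\<close> of \<open>cmod f powr s\<close> is the \<open>\<gamma>\<close>-th root of the mean of
  \<open>cmod f powr (s * \<gamma>)\<close>, and the disc about \<open>z\<close> fills a fixed proportion of the box. So this is
  the estimate of point values for the exponent \<open>s * \<gamma>\<close>, which may be any positive number;
  for \<open>s = 0\<close> the average and the function are both 1.\<close>

lemma abs_pow_le_avg:
  fixes s \<gamma> \<alpha> :: real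
  assumes s: "0 \<le> s" and \<gamma>: "1 \<le> \<gamma>" and \<alpha>: "-1 < \<alpha>"
  obtains K where "0 < K" and "\<And>f z I. f holomorphic_on upper_half_plane \<Longrightarrow> z \<in> upper_half_plane \<Longrightarrow>
    bounded_interval I \<Longrightarrow> ball z (Im z / 2) \<subseteq> carleson_box I \<Longrightarrow> interval_length I \<le> 12 * Im z \<Longrightarrow>
    ennreal (abs_pow f s z) \<le> ennreal K * avg \<alpha> (carleson_box I) \<gamma> (abs_pow f s)"
proof -
  have box_pos: "0 < 2 powr \<alpha> / pi * interval_length I powr (\<alpha> + 2)" if "bounded_interval I" for I
    using that by (simp add: bounded_interval_def)
  show ?thesis
  proof (cases "s = 0")
    case True
    show ?thesis
    proof (rule that[of 1])
      fix f :: "complex \<Rightarrow> complex" and z I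
      assume I: "bounded_interval I"
      have sets: "carleson_box I \<in> sets (bergman_measure \<alpha>)"
        by (rule carleson_box_in_sets_bergman[OF I])
      define A where "A = 2 powr \<alpha> / pi * interval_length I powr (\<alpha> + 2)"
      have "ennreal A / ennreal A = 1"
        using box_pos[OF I] by (subst divide_ennreal) (auto simp: A_def)
      then have "avg \<alpha> (carleson_box I) \<gamma> (abs_pow f s) = 1"
        using True sets
        by (simp add: avg_def abs_pow_def bergman_measure_carleson_box[OF I \<alpha>, folded A_def] epowr_def)
      then show "ennreal (abs_pow f s z) \<le> ennreal 1 * avg \<alpha> (carleson_box I) \<gamma> (abs_pow f s)"
        using True by (simp add: abs_pow_def)
    qed simp
  next
    case False
    then have s\<gamma>: "0 < s * \<gamma>"
      using s \<gamma> by simp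
    obtain K where K: "0 < K" and mean: "\<And>f z E. f holomorphic_on upper_half_plane \<Longrightarrow>
        z \<in> upper_half_plane \<Longrightarrow> ball z (Im z / 2) \<subseteq> E \<Longrightarrow>
        ennreal (Im z powr (\<alpha> + 2) * cmod (f z) powr (s * \<gamma>))
        \<le> ennreal K * (\<integral>\<^sup>+w\<in>E. ennreal (cmod (f w) powr (s * \<gamma>)) \<partial>bergman_measure \<alpha>)"
      using norm_powr_le_bergman_integral[OF s\<gamma> \<alpha>] by blast
    define c where "c = 2 powr \<alpha> / pi * 12 powr (\<alpha> + 2)"
    have c: "0 < c"
      by (simp add: c_def)
    show ?thesis
    proof (rule that[of "(c * K) powr (1 / \<gamma>)"])
      show "0 < (c * K) powr (1 / \<gamma>)"
        using c K by simp
    next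
      fix f z I
      assume holo: "f holomorphic_on upper_half_plane" and z: "z \<in> upper_half_plane"
        and I: "bounded_interval I" and ball: "ball z (Im z / 2) \<subseteq> carleson_box I"
        and short: "interval_length I \<le> 12 * Im z"
      define A where "A = 2 powr \<alpha> / pi * interval_length I powr (\<alpha> + 2)"
      define T where "T = (\<integral>\<^sup>+w\<in>carleson_box I. ennreal (cmod (f w) powr (s * \<gamma>)) \<partial>bergman_measure \<alpha>)"
      have A: "0 < A"
        using box_pos[OF I] by (simp add: A_def)
      have "interval_length I powr (\<alpha> + 2) \<le> (12 * Im z) powr (\<alpha> + 2)"
        using short \<alpha> by (intro powr_mono2) auto
      also have "\<dots> = 12 powr (\<alpha> + 2) * Im z powr (\<alpha> + 2)"
        using z by (simp add: powr_mult upper_half_plane_def)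
      finally have "A \<le> c * Im z powr (\<alpha> + 2)"
        unfolding A_def c_def mult.assoc by (rule mult_left_mono) simp
      then have "1 \<le> c / A * Im z powr (\<alpha> + 2)"
        using A by simp
      then have "1 * cmod (f z) powr (s * \<gamma>) \<le> c / A * Im z powr (\<alpha> + 2) * cmod (f z) powr (s * \<gamma>)"
        by (rule mult_right_mono) simp
      then have "ennreal (cmod (f z) powr (s * \<gamma>))
          \<le> ennreal (c / A * (Im z powr (\<alpha> + 2) * cmod (f z) powr (s * \<gamma>)))"
        by (intro ennreal_leI) (simp add: mult.assoc)
      also have "\<dots> = ennreal (c / A) * ennreal (Im z powr (\<alpha> + 2) * cmod (f z) powr (s * \<gamma>))"
        using c A by (intro ennreal_mult) auto
      also have "\<dots> \<le> ennreal (c / A) * (ennreal K * T)"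
        unfolding T_def using mean[OF holo z ball] by (rule mult_left_mono) simp
      also have "\<dots> = ennreal (c * K) * (T / ennreal A)"
      proof -
        have "c / A = c * inverse A"
          by (simp add: divide_inverse)
        then show ?thesis
          using c A K by (simp add: divide_ennreal_def inverse_ennreal[symmetric] ennreal_mult mult_ac)
      qed
      finally have "epowr (ennreal (cmod (f z) powr (s * \<gamma>))) (1 / \<gamma>)
          \<le> epowr (ennreal (c * K) * (T / ennreal A)) (1 / \<gamma>)"
        using \<gamma> by (intro epowr_mono) auto
      moreover have "epowr (ennreal (cmod (f z) powr (s * \<gamma>))) (1 / \<gamma>) = ennreal (abs_pow f s z)"
        using \<gamma> False by (simp add: epowr_ennreal' powr_powr abs_pow_def)
      moreover have "avg \<alpha> (carleson_box I) \<gamma> (abs_pow f s) = epowr (T / ennreal A) (1 / \<gamma>)"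
        using False by (simp add: avg_def T_def A_def abs_pow_def powr_powr bergman_measure_carleson_box[OF I \<alpha>])
      ultimately show "ennreal (abs_pow f s z)
          \<le> ennreal ((c * K) powr (1 / \<gamma>)) * avg \<alpha> (carleson_box I) \<gamma> (abs_pow f s)"
        using c K by (simp add: epowr_cmult)
    qed
  qed
qed

lemma infsum_eq_nn_integral_count_space:
  fixes f :: "'a \<Rightarrow> ennreal"
  assumes "countable A"
  shows "infsum f A = (\<integral>\<^sup>+x. f x \<partial>count_space A)"
proof (cases "finite A")
  case True
  then show ?thesis
    by (simp add: nn_integral_count_space_finite)
next
  case False
  let ?g = "from_nat_into A"
  have bij: "bij_betw ?g UNIV A"
    using assms False by (rule bij_betw_from_nat_into)
  have "(\<lambda>n. f (?g n)) summable_on UNIV"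
    by (rule nonneg_summable_on_complete) simp
  then have "(\<lambda>n. f (?g n)) sums infsum (\<lambda>n. f (?g n)) UNIV"
    by (intro has_sum_imp_sums has_sum_infsum)
  then have "infsum (\<lambda>n. f (?g n)) UNIV = (\<Sum>n. f (?g n))"
    by (rule sums_unique)
  also have "\<dots> = (\<integral>\<^sup>+x. f x \<partial>count_space A)"
    by (simp add: nn_integral_bij_count_space[OF bij, symmetric] nn_integral_count_space_nat)
  finally show ?thesis
    by (simp add: infsum_reindex_bij_betw[OF bij])
qed

lemma nn_integral_le_sum_over_grids:
  fixes c :: "'i \<Rightarrow> 'a \<Rightarrow> ennreal" and h :: "'i \<Rightarrow> 'a \<Rightarrow> 'b \<Rightarrow> ennreal"
  assumes fin: "finite S" and D: "\<And>i. i \<in> S \<Longrightarrow> countable (D i)"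
    and h: "\<And>i J. i \<in> S \<Longrightarrow> J \<in> D i \<Longrightarrow> h i J \<in> borel_measurable M"
    and le: "\<And>z. z \<in> space M \<Longrightarrow> \<exists>i\<in>S. \<exists>J\<in>D i. g z \<le> c i J * h i J z"
  shows "(\<integral>\<^sup>+z. g z \<partial>M) \<le> (\<Sum>i\<in>S. \<Sum>\<^sub>\<infinity>J\<in>D i. c i J * (\<integral>\<^sup>+z. h i J z \<partial>M))"
proof -
  have meas: "(\<lambda>z. c i J * h i J z) \<in> borel_measurable M" if "i \<in> S" "J \<in> D i" for i J
    using h[OF that] by measurable
  have "(\<integral>\<^sup>+z. g z \<partial>M) \<le> (\<integral>\<^sup>+z. (\<Sum>i\<in>S. \<integral>\<^sup>+J. c i J * h i J z \<partial>count_space (D i)) \<partial>M)"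
  proof (rule nn_integral_mono)
    fix z assume "z \<in> space M"
    then obtain i J where iJ: "i \<in> S" "J \<in> D i" "g z \<le> c i J * h i J z"
      using le by blast
    note iJ(3)
    also have "c i J * h i J z \<le> (\<integral>\<^sup>+J. c i J * h i J z \<partial>count_space (D i))"
      using iJ(2) by (rule nn_integral_ge_point)
    also have "\<dots> \<le> (\<Sum>i\<in>S. \<integral>\<^sup>+J. c i J * h i J z \<partial>count_space (D i))"
      using iJ(1) fin by (intro member_le_sum) auto
    finally show "g z \<le> (\<Sum>i\<in>S. \<integral>\<^sup>+J. c i J * h i J z \<partial>count_space (D i))" .
  qed
  also have "\<dots> = (\<Sum>i\<in>S. \<integral>\<^sup>+z. \<integral>\<^sup>+J. c i J * h i J z \<partial>count_space (D i) \<partial>M)"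
  proof (rule nn_integral_sum)
    fix i assume i: "i \<in> S"
    interpret sigma_finite_measure "count_space (D i)"
      by (rule sigma_finite_measure_count_space_countable[OF D[OF i]])
    have "(\<lambda>(z, J). c i J * h i J z) \<in> borel_measurable (M \<Otimes>\<^sub>M count_space (D i))"
      unfolding case_prod_beta
      by (rule measurable_compose_countable'[where f="\<lambda>J zJ. c i J * h i J (fst zJ)" and g=snd, OF _ _ D[OF i]])
         (use meas[OF i] in \<open>auto intro: measurable_compose[OF measurable_fst]\<close>)
    then show "(\<lambda>z. \<integral>\<^sup>+J. c i J * h i J z \<partial>count_space (D i)) \<in> borel_measurable M"
      by (rule borel_measurable_nn_integral)
  qed
  also have "\<dots> = (\<Sum>i\<in>S. \<integral>\<^sup>+J. \<integral>\<^sup>+z. c i J * h i J z \<partial>M \<partial>count_space (D i))"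
    using meas D by (intro sum.cong nn_integral_count_space_nn_integral) auto
  also have "\<dots> = (\<Sum>i\<in>S. \<Sum>\<^sub>\<infinity>J\<in>D i. c i J * (\<integral>\<^sup>+z. h i J z \<partial>M))"
    using h D by (intro sum.cong) (auto simp: infsum_eq_nn_integral_count_space nn_integral_cmult intro!: nn_integral_cong)
  finally show ?thesis .
qed

text \<open>Only the factor \<open>epowr \<mu> (1 / \<gamma>)\<close> of \<open>\<mu>\<close> is estimated by the Carleson condition; the remaining
  power of \<open>\<mu>\<close> is kept.\<close>

lemma epowr_pullback_le_epowr_area:
  fixes p q \<alpha> C \<gamma> :: real
  assumes \<alpha>: "-1 < \<alpha>" and \<gamma>: "1 \<le> \<gamma>" and C: "0 < C"
    and I: "bounded_interval I"
    and \<mu>: "\<mu> \<le> ennreal (C * interval_length I powr ((\<alpha> + 2) * q / p))"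
  shows "\<mu> \<le> ennreal (C powr (1 / \<gamma>) * (2 powr \<alpha> / pi) powr (- (q / (p * \<gamma>)))) *
    (epowr \<mu> (1 - 1 / \<gamma>) * epowr (emeasure (bergman_measure \<alpha>) (carleson_box I)) (q / (p * \<gamma>)))"
proof -
  define L a e where "L = interval_length I" and "a = 2 powr \<alpha> / pi" and "e = q / (p * \<gamma>)"
  have L: "0 < L" and a: "0 < a"
    using I by (auto simp: bounded_interval_def L_def a_def)
  have "epowr \<mu> (1 / \<gamma>) \<le> epowr (ennreal (C * L powr ((\<alpha> + 2) * q / p))) (1 / \<gamma>)"
    using \<mu> \<gamma> by (intro epowr_mono) (auto simp: L_def)
  also have "\<dots> = ennreal ((C * L powr ((\<alpha> + 2) * q / p)) powr (1 / \<gamma>))"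
    using C L by (intro epowr_ennreal) auto
  also have "(C * L powr ((\<alpha> + 2) * q / p)) powr (1 / \<gamma>)
      = (C powr (1 / \<gamma>) * a powr (- e)) * (a * L powr (\<alpha> + 2)) powr e"
    using C L a by (simp add: powr_mult powr_powr powr_minus e_def)
  also have "ennreal \<dots> = ennreal (C powr (1 / \<gamma>) * a powr (- e)) * epowr (emeasure (bergman_measure \<alpha>) (carleson_box I)) e"
    unfolding bergman_measure_carleson_box[OF I \<alpha>] L_def[symmetric] a_def[symmetric]
    using L a by (subst epowr_ennreal) (auto simp: ennreal_mult)
  finally have "epowr \<mu> (1 - 1 / \<gamma>) * epowr \<mu> (1 / \<gamma>)
      \<le> epowr \<mu> (1 - 1 / \<gamma>) * (ennreal (C powr (1 / \<gamma>) * a powr (- e)) * epowr (emeasure (bergman_measure \<alpha>) (carleson_box I)) e)"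
    by (rule mult_left_mono) simp
  then show ?thesis
    unfolding epowr_conjugate_mult[OF \<gamma>] a_def e_def by (simp add: mult_ac)
qed

text \<open>At \<open>v = \<phi> z\<close> the product of the bounds for \<open>cmod (f v) powr N\<close> and \<open>cmod (f v) powr (q - N)\<close>
  by averages over one box containing \<open>v\<close> gives a constant on that box. Integration against
  \<open>cmod (u z) powr q\<close> over the preimage of the box turns it into a multiple of the pullback measure,
  to which the Carleson condition applies.\<close>

lemma weighted_comp_norm_le_grid_sum:
  fixes p q \<alpha> \<gamma> :: real and u \<phi> :: "complex \<Rightarrow> complex" and D :: "nat \<Rightarrow> real set set" and N :: nat
  assumes grid: "\<And>i. i \<in> {1..3} \<Longrightarrow> dyadic_grid (D i)"
    and cover: "\<And>I. bounded_interval I \<Longrightarrow>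
      \<exists>i\<in>{1..3}. \<exists>J\<in>D i. I \<subseteq> J \<and> interval_length J \<le> 3 * interval_length I"
    and p: "1 \<le> p" and q: "p \<le> q" and \<alpha>: "-1 < \<alpha>"
    and u: "u holomorphic_on upper_half_plane" and \<phi>: "\<phi> holomorphic_on upper_half_plane"
    and maps: "\<phi> ` upper_half_plane \<subseteq> upper_half_plane"
    and bdd: "weighted_comp_bounded p q \<alpha> u \<phi>"
    and \<gamma>: "1 \<le> \<gamma>" and N: "1 \<le> N" "real N \<le> p"
  shows "\<exists>C>0. \<forall>f\<in>bergman_space p \<alpha>.
    epowr (bergman_norm q \<alpha> (weighted_comp u \<phi> f)) q \<le> ennreal C *
      (\<Sum>i=1..3. \<Sum>\<^sub>\<infinity>I\<in>D i.
         epowr (pullback_measure u \<phi> q \<alpha> (carleson_box I)) (1 - 1 / \<gamma>)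
         * epowr (emeasure (bergman_measure \<alpha>) (carleson_box I)) (q / (p * \<gamma>))
         * avg \<alpha> (carleson_box I) 1 (abs_pow f (real N))
         * avg \<alpha> (carleson_box I) \<gamma> (abs_pow f (q - real N)))"
proof -
  let ?\<mu> = "\<lambda>I. pullback_measure u \<phi> q \<alpha> (carleson_box I)"
  let ?A = "\<lambda>I. emeasure (bergman_measure \<alpha>) (carleson_box I)"
  let ?X = "\<lambda>f I. avg \<alpha> (carleson_box I) 1 (abs_pow f (real N))"
  let ?Y = "\<lambda>f I. avg \<alpha> (carleson_box I) \<gamma> (abs_pow f (q - real N))"
  obtain K1 where K1: "0 < K1" and avg1: "\<And>f z I. f holomorphic_on upper_half_plane \<Longrightarrow>
      z \<in> upper_half_plane \<Longrightarrow> bounded_interval I \<Longrightarrow> ball z (Im z / 2) \<subseteq> carleson_box I \<Longrightarrow>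
      interval_length I \<le> 12 * Im z \<Longrightarrow> ennreal (abs_pow f (real N) z) \<le> ennreal K1 * ?X f I"
    using abs_pow_le_avg[of "real N" 1 \<alpha>] \<alpha> by auto
  obtain K2 where K2: "0 < K2" and avg2: "\<And>f z I. f holomorphic_on upper_half_plane \<Longrightarrow>
      z \<in> upper_half_plane \<Longrightarrow> bounded_interval I \<Longrightarrow> ball z (Im z / 2) \<subseteq> carleson_box I \<Longrightarrow>
      interval_length I \<le> 12 * Im z \<Longrightarrow> ennreal (abs_pow f (q - real N) z) \<le> ennreal K2 * ?Y f I"
    using abs_pow_le_avg[of "q - real N" \<gamma> \<alpha>] \<alpha> \<gamma> q N by auto
  obtain K3 where K3: "0 < K3" and carleson: "\<And>I. bounded_interval I \<Longrightarrow>
      ?\<mu> I \<le> ennreal (K3 * interval_length I powr ((\<alpha> + 2) * q / p))"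
    using pullback_measure_carleson_box_le[OF p q \<alpha> u \<phi> maps bdd] by blast
  define K4 where "K4 = K3 powr (1 / \<gamma>) * (2 powr \<alpha> / pi) powr (- (q / (p * \<gamma>)))"
  have K4: "0 < K4"
    using K3 by (simp add: K4_def)
  have grid_int: "bounded_interval J" if "i \<in> {1..3}" "J \<in> D i" for i J
    using grid[OF that(1)] that(2) by (auto simp: dyadic_grid_def)
  have count: "countable (D i)" if "i \<in> {1..3}" for i
    by (rule countable_dyadic_grid[OF grid[OF that]])
  define h where "h = (\<lambda>(i::nat) J z. ennreal (cmod (u z) powr q) * indicator (\<phi> -` carleson_box J \<inter> upper_half_plane) z :: ennreal)"
  have h_meas: "h i J \<in> borel_measurable (bergman_measure \<alpha>)" if "i \<in> {1..3}" "J \<in> D i" for i J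
  proof -
    have "\<phi> \<in> borel_measurable (restrict_space borel upper_half_plane)"
      by (intro borel_measurable_continuous_on_restrict holomorphic_on_imp_continuous_on \<phi>)
    from measurable_sets[OF this sets_carleson_box[OF grid_int[OF that]]]
    have "\<phi> -` carleson_box J \<inter> upper_half_plane \<in> sets (bergman_measure \<alpha>)"
      by (simp add: sets_bergman_measure space_restrict_space)
    then show ?thesis
      unfolding h_def using norm_powr_measurable_bergman[OF u, of q \<alpha>] p q
      by (intro borel_measurable_times_ennreal borel_measurable_indicator) auto
  qed
  have h_int: "(\<integral>\<^sup>+z. h i J z \<partial>bergman_measure \<alpha>) = ?\<mu> J" for i J
    by (simp add: h_def pullback_measure_def)
  have bound: "epowr (bergman_norm q \<alpha> (weighted_comp u \<phi> f)) q \<le> ennreal (K1 * K2 * K4) *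
      (\<Sum>i=1..3. \<Sum>\<^sub>\<infinity>I\<in>D i. epowr (?\<mu> I) (1 - 1 / \<gamma>) * epowr (?A I) (q / (p * \<gamma>)) * ?X f I * ?Y f I)"
    if f: "f \<in> bergman_space p \<alpha>" for f
  proof -
    have holo: "f holomorphic_on upper_half_plane"
      using f by (simp add: bergman_space_def)
    define c where "c = (\<lambda>(i::nat) J. ennreal (K1 * K2) * (?X f J * ?Y f J))"
    have point: "\<exists>i\<in>{1..3}. \<exists>J\<in>D i. ennreal (cmod (weighted_comp u \<phi> f z) powr q) \<le> c i J * h i J z"
      if "z \<in> space (bergman_measure \<alpha>)" for z
    proof -
      have z: "z \<in> upper_half_plane" "\<phi> z \<in> upper_half_plane"
        using that maps by auto
      obtain i J where iJ: "i \<in> {1..3}" "J \<in> D i" and J: "bounded_interval J"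
        "ball (\<phi> z) (Im (\<phi> z) / 2) \<subseteq> carleson_box J" "interval_length J \<le> 12 * Im (\<phi> z)"
        using dyadic_box_around_point[OF grid cover z(2)] by metis
      have "\<phi> z \<in> carleson_box J"
        using J(2) z(2) by (auto simp: upper_half_plane_def)
      then have h_eq: "h i J z = ennreal (cmod (u z) powr q)"
        using z by (simp add: h_def)
      have "cmod (f (\<phi> z)) powr q = abs_pow f (real N) (\<phi> z) * abs_pow f (q - real N) (\<phi> z)"
        using N by (auto simp: abs_pow_def powr_add[symmetric])
      then have "ennreal (cmod (f (\<phi> z)) powr q)
          = ennreal (abs_pow f (real N) (\<phi> z)) * ennreal (abs_pow f (q - real N) (\<phi> z))"
        by (simp add: ennreal_mult abs_pow_def)
      also have "\<dots> \<le> (ennreal K1 * ?X f J) * (ennreal K2 * ?Y f J)"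
        using avg1[OF holo z(2) J] avg2[OF holo z(2) J] by (rule mult_mono) auto
      also have "\<dots> = c i J"
        using K1 K2 by (simp add: c_def ennreal_mult mult_ac)
      finally have "ennreal (cmod (f (\<phi> z)) powr q) * ennreal (cmod (u z) powr q) \<le> c i J * h i J z"
        unfolding h_eq by (rule mult_right_mono) simp
      then show ?thesis
        using iJ by (auto simp: weighted_comp_def norm_mult powr_mult ennreal_mult[symmetric] mult.commute)
    qed
    have "epowr (bergman_norm q \<alpha> (weighted_comp u \<phi> f)) q
        = (\<integral>\<^sup>+z. ennreal (cmod (weighted_comp u \<phi> f z) powr q) \<partial>bergman_measure \<alpha>)"
      using p q by (simp add: bergman_norm_def epowr_epowr_inverse)
    also have "\<dots> \<le> (\<Sum>i=1..3. \<Sum>\<^sub>\<infinity>J\<in>D i. c i J * (\<integral>\<^sup>+z. h i J z \<partial>bergman_measure \<alpha>))"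
      using count h_meas point by (intro nn_integral_le_sum_over_grids) auto
    also have "\<dots> \<le> (\<Sum>i=1..3. \<Sum>\<^sub>\<infinity>J\<in>D i. ennreal (K1 * K2 * K4) *
        (epowr (?\<mu> J) (1 - 1 / \<gamma>) * epowr (?A J) (q / (p * \<gamma>)) * ?X f J * ?Y f J))"
    proof (intro sum_mono infsum_mono nonneg_summable_on_complete)
      fix i J assume iJ: "i \<in> {1..3}" "J \<in> D i"
      have J: "bounded_interval J"
        by (rule grid_int[OF iJ])
      have "c i J * ?\<mu> J \<le> c i J * (ennreal K4 * (epowr (?\<mu> J) (1 - 1 / \<gamma>) * epowr (?A J) (q / (p * \<gamma>))))"
        unfolding K4_def
        by (intro mult_left_mono epowr_pullback_le_epowr_area[OF \<alpha> \<gamma> K3 J carleson[OF J]]) simp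
      then show "c i J * (\<integral>\<^sup>+z. h i J z \<partial>bergman_measure \<alpha>) \<le> ennreal (K1 * K2 * K4) *
          (epowr (?\<mu> J) (1 - 1 / \<gamma>) * epowr (?A J) (q / (p * \<gamma>)) * ?X f J * ?Y f J)"
        unfolding h_int c_def using K1 K2 K4 by (simp add: ennreal_mult mult_ac)
    qed auto
    also have "\<dots> = ennreal (K1 * K2 * K4) * (\<Sum>i=1..3. \<Sum>\<^sub>\<infinity>J\<in>D i.
        epowr (?\<mu> J) (1 - 1 / \<gamma>) * epowr (?A J) (q / (p * \<gamma>)) * ?X f J * ?Y f J)"
      unfolding sum_distrib_left
      by (intro sum.cong refl) (simp add: infsum_eq_nn_integral_count_space[OF count] nn_integral_cmult)
    finally show ?thesis .
  qed
  show ?thesis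
    using bound K1 K2 K4 by (intro exI[of _ "K1 * K2 * K4"]) auto
qed

theorem proposition4p3:
  fixes p q \<alpha> \<gamma> :: real and u \<phi> :: "complex \<Rightarrow> complex" and D :: "nat \<Rightarrow> real set set"
  assumes "\<And>i. i \<in> {1..3} \<Longrightarrow> dyadic_grid (D i)"
    and "\<And>I. bounded_interval I \<Longrightarrow>
           \<exists>i\<in>{1..3}. \<exists>J\<in>D i. I \<subseteq> J \<and> interval_length J \<le> 3 * interval_length I"
    and "1 \<le> p" and "p \<le> q" and "-1 < \<alpha>"
    and "u holomorphic_on upper_half_plane"
    and "\<phi> holomorphic_on upper_half_plane"
    and "\<phi> ` upper_half_plane \<subseteq> upper_half_plane"
    and "weighted_comp_bounded p q \<alpha> u \<phi>"
    and "1 \<le> \<gamma>"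
  shows "\<exists>C::real. C > 0 \<and> (\<forall>f\<in>bergman_space p \<alpha>.
           epowr (bergman_norm q \<alpha> (weighted_comp u \<phi> f)) q
           \<le> ennreal C *
             (INF N\<in>{N::nat. 1 \<le> N \<and> real N \<le> p}.
                \<Sum>i=1..3. \<Sum>\<^sub>\<infinity>I\<in>D i.
                  epowr (pullback_measure u \<phi> q \<alpha> (carleson_box I)) (1 - 1 / \<gamma>)
                  * epowr (emeasure (bergman_measure \<alpha>) (carleson_box I)) (q / (p * \<gamma>))
                  * avg \<alpha> (carleson_box I) 1 (abs_pow f (real N))
                  * avg \<alpha> (carleson_box I) \<gamma> (abs_pow f (q - real N))))"
proof -
  define S where "S = (\<lambda>f N. \<Sum>i=1..3. \<Sum>\<^sub>\<infinity>I\<in>D i.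
    epowr (pullback_measure u \<phi> q \<alpha> (carleson_box I)) (1 - 1 / \<gamma>)
    * epowr (emeasure (bergman_measure \<alpha>) (carleson_box I)) (q / (p * \<gamma>))
    * avg \<alpha> (carleson_box I) 1 (abs_pow f (real N))
    * avg \<alpha> (carleson_box I) \<gamma> (abs_pow f (q - real N)))"
  define Ns where "Ns = {N::nat. 1 \<le> N \<and> real N \<le> p}"
  have "Ns \<subseteq> {..nat \<lceil>p\<rceil>}"
    by (auto simp: Ns_def) linarith
  then have fin: "finite Ns"
    by (rule finite_subset) simp
  have one: "1 \<in> Ns"
    using \<open>1 \<le> p\<close> by (simp add: Ns_def)
  \<comment> \<open>only finitely many \<open>N\<close> occur, so their constants can be added up\<close>
  have "\<exists>C>0. \<forall>f\<in>bergman_space p \<alpha>.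
      epowr (bergman_norm q \<alpha> (weighted_comp u \<phi> f)) q \<le> ennreal C * S f N" if "N \<in> Ns" for N
    unfolding S_def using that by (intro weighted_comp_norm_le_grid_sum assms) (auto simp: Ns_def)
  then obtain C where C: "\<And>N. N \<in> Ns \<Longrightarrow> 0 < C N" and bound: "\<And>N f. N \<in> Ns \<Longrightarrow> f \<in> bergman_space p \<alpha> \<Longrightarrow>
      epowr (bergman_norm q \<alpha> (weighted_comp u \<phi> f)) q \<le> ennreal (C N) * S f N"
    by metis
  have "epowr (bergman_norm q \<alpha> (weighted_comp u \<phi> f)) q \<le> ennreal (\<Sum>N\<in>Ns. C N) * (INF N\<in>Ns. S f N)"
    if f: "f \<in> bergman_space p \<alpha>" for f
  proof -
    have "(INF N\<in>Ns. S f N) \<in> S f ` Ns"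
      using fin one by (subst cInf_eq_Min) (auto intro!: Min_in)
    then obtain M where M: "M \<in> Ns" "(INF N\<in>Ns. S f N) = S f M"
      by blast
    have "C M \<le> (\<Sum>N\<in>Ns. C N)"
      using M(1) fin C by (intro member_le_sum) (auto intro: less_imp_le)
    then have "ennreal (C M) * S f M \<le> ennreal (\<Sum>N\<in>Ns. C N) * S f M"
      by (intro mult_right_mono ennreal_leI) auto
    with bound[OF M(1) f] show ?thesis
      unfolding M(2) by (rule order_trans)
  qed
  moreover have "0 < (\<Sum>N\<in>Ns. C N)"
    using fin one C by (intro sum_pos) auto
  ultimately show ?thesis
    unfolding S_def Ns_def by blast
qed

end
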